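(* There exists an uncountable set $\mathcal T\subset C(I)$ of crooked interval maps with topological entropy $0$ such that any two different $f,g\in\mathcal T$ are not topologically conjugate.
   Context: $I=[0,1]$. A map $f\colon I\to I$ is a continuous surjective function, and $C(I)$ denotes the set of all such interval maps. Maps $f,g\in C(I)$ are (topologically) conjugate if there is a homeomorphism $h\colon I\to I$ with $g=h\circ f\circ h^{-1}$. Topological entropy is the standard one for continuous self-maps of compact metric spaces. For $a,b\in I$ and $\delta>0$, a map $f$ is $\delta$-crooked between $a$ and $b$ if for every two points $c,d\in I$ with $f(c)=a$ and $f(d)=b$ there is a point $c'$ between $c$ and $d$ and a point $d'$ between $c'$ and $d$ such that $|b-f(c')|<\delta$ and $|a-f(d')|<\delta$ ("between" allows endpoints). The map $f$ is $\delta$-crooked if it is $\delta$-crooked between every pair of points of $I$. The map $f$ is crooked if for every $\delta>0$ there exists $n\in\mathbb N$ such that $f^n$ is $\delta$-crooked. *)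

theory Defs
  imports "HOL-Analysis.Analysis"
begin

abbreviation I01 :: "real set" where
  "I01 \<equiv> {0..1}"

text \<open>
  Interval maps are represented by functions \<open>real \<Rightarrow> real\<close> that are \<open>undefined\<close> outside
  the unit interval, so that equality of two elements of \<open>C_I\<close> is equality of maps on the
  interval.
\<close>

definition C_I :: "(real \<Rightarrow> real) set" where
  "C_I = {f \<in> extensional I01. continuous_on I01 f \<and> f ` I01 = I01}"

definition conjugate_maps :: "(real \<Rightarrow> real) \<Rightarrow> (real \<Rightarrow> real) \<Rightarrow> bool" where
  "conjugate_maps f g \<longleftrightarrow>
     (\<exists>h h'. homeomorphism I01 I01 h h' \<and> (\<forall>x\<in>I01. g x = h (f (h' x))))"

text \<open>
  Note that \<open>c\<close> may lie on either side of \<open>d\<close>; \<open>closed_segment\<close> on the reals does not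
  presuppose an order of its endpoints.
\<close>

definition delta_crooked_between :: "real \<Rightarrow> (real \<Rightarrow> real) \<Rightarrow> real \<Rightarrow> real \<Rightarrow> bool" where
  "delta_crooked_between \<delta> f a b \<longleftrightarrow>
     (\<forall>c\<in>I01. \<forall>d\<in>I01. f c = a \<and> f d = b \<longrightarrow>
        (\<exists>c'\<in>closed_segment c d. \<exists>d'\<in>closed_segment c' d.
           \<bar>b - f c'\<bar> < \<delta> \<and> \<bar>a - f d'\<bar> < \<delta>))"

definition delta_crooked :: "real \<Rightarrow> (real \<Rightarrow> real) \<Rightarrow> bool" where
  "delta_crooked \<delta> f \<longleftrightarrow> (\<forall>a\<in>I01. \<forall>b\<in>I01. delta_crooked_between \<delta> f a b)"

definition crooked :: "(real \<Rightarrow> real) \<Rightarrow> bool" where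
  "crooked f \<longleftrightarrow> (\<forall>\<delta>>0. \<exists>n\<ge>1. delta_crooked \<delta> (f ^^ n))"

text \<open>
  Topological entropy of a continuous self-map of a compact metric space \<open>X\<close>, following Bowen
  and Dinaburg: \<open>spanning_number X f n \<epsilon>\<close> is the least cardinality of a subset of \<open>X\<close> that is
  \<open>\<epsilon>\<close>-dense in the metric \<open>max {d (f\<^sup>i x) (f\<^sup>i y) | i < n}\<close>. It is meaningful since, by
  compactness, finite spanning sets exist. The exponential growth rate of these numbers increases
  as \<open>\<epsilon>\<close> decreases, so its limit for \<open>\<epsilon> \<rightarrow> 0\<close> is a supremum.
\<close>

definition spanning_set ::
    "'a::metric_space set \<Rightarrow> ('a \<Rightarrow> 'a) \<Rightarrow> nat \<Rightarrow> real \<Rightarrow> 'a set \<Rightarrow> bool" where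
  "spanning_set X f n \<epsilon> F \<longleftrightarrow>
     F \<subseteq> X \<and> (\<forall>x\<in>X. \<exists>y\<in>F. \<forall>i<n. dist ((f ^^ i) x) ((f ^^ i) y) \<le> \<epsilon>)"

definition spanning_number ::
    "'a::metric_space set \<Rightarrow> ('a \<Rightarrow> 'a) \<Rightarrow> nat \<Rightarrow> real \<Rightarrow> nat" where
  "spanning_number X f n \<epsilon> = (INF F\<in>{F. finite F \<and> spanning_set X f n \<epsilon> F}. card F)"

definition topological_entropy :: "'a::metric_space set \<Rightarrow> ('a \<Rightarrow> 'a) \<Rightarrow> ereal" where
  "topological_entropy X f =
     (SUP \<epsilon>\<in>{0<..}. limsup (\<lambda>n. ereal (ln (real (spanning_number X f n \<epsilon>)) / real n)))"

end

(*
  The maps constructed here satisfy f(0) = 0, f(1) = 1 and f(x) > x in between, so orbits are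
  increasing and the entropy vanishes. Near the repelling fixed point 0 all approximations are
  x |-> 2x, and crookedness is created there by Henderson's notches: to make f^n crooked between
  a and b, take an interval [u, v] on which f^n crosses from one of a, b to the other and add to f,
  near 2^-M u for a large M, a narrow tent of height about 2 * 2^-M v. For suitable r the map
  g^r then runs from u to almost v, back to almost u, and on to v, so that f^n o g^r crosses,
  almost returns and crosses again. The tent acts on all scales 2^k [u, v] at once and might
  duplicate other crossings; this cannot happen to the unrepaired ones if [u, v] is chosen among
  them with minimal ratio v / u. Hence each tent lowers the number of unrepaired crossings. Later
  tents live so close to 0 that they leave the crossings between a and b untouched, and the
  limit is crooked. It coincides on [1/4, 1] with a prescribed map, into which a conjugacy
  invariant in the form of an arbitrary subset of the natural numbers is built.
*)

theory Submission
  imports Defs "HOL-Real_Asymp.Real_Asymp"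
begin

text \<open>The obstacle is to keep the number of unrepaired crossings from growing while the
  exponent does. A bad crossing of the later iterate is carried by \<open>g ^^ r\<close> to a bad
  crossing of the earlier one, and two of them carried to the same [s, t] force
  \<open>g ^^ r\<close> to drop from t to s in between. Since the map doubles near 0, such a drop
  stays within some 2^k [u + \<eta>, v - \<eta>]. The ratio t / s does not change under doubling,
  which makes it the right measure: an interval of ratio at least v / u does not fit into one of
  smaller ratio. Crookedness is reduced to countably many pairs of levels i / N and j / N. The
  levels 0 and 1 are excluded, because the argument rests on iterates being below both levels near 0
  and eventually above both away from 0. A pair treated for one exponent is treated for all larger
  ones, so the finitely many pairs belonging to one N can share an exponent.\<close>

section \<open>Crossings\<close>

text \<open>A map crooked between \<open>F u\<close> and \<open>F v\<close> must run over \<open>[u, v]\<close> from \<open>F u\<close> almost to \<open>F v\<close>, back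
  almost to \<open>F u\<close>, and on to \<open>F v\<close>. Read from right to left this is the same condition, so
  crossings need not be oriented.\<close>

definition returns :: "real \<Rightarrow> (real \<Rightarrow> real) \<Rightarrow> real \<Rightarrow> real \<Rightarrow> bool" where
  "returns \<delta> F u v \<longleftrightarrow>
     (\<exists>x y. u \<le> x \<and> x \<le> y \<and> y \<le> v \<and> \<bar>F x - F v\<bar> < \<delta> \<and> \<bar>F y - F u\<bar> < \<delta>)"

definition crossing :: "(real \<Rightarrow> real) \<Rightarrow> real \<Rightarrow> real \<Rightarrow> real \<Rightarrow> real \<Rightarrow> bool" where
  "crossing F a b u v \<longleftrightarrow> 0 \<le> u \<and> u < v \<and> v \<le> 1 \<and> {F u, F v} = {a, b} \<and>
     (\<forall>x. u < x \<and> x < v \<longrightarrow> F x \<noteq> a \<and> F x \<noteq> b)"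

definition bad_crossings :: "real \<Rightarrow> (real \<Rightarrow> real) \<Rightarrow> real \<Rightarrow> real \<Rightarrow> (real \<times> real) set" where
  "bad_crossings \<delta> F a b = {(u, v). crossing F a b u v \<and> \<not> returns \<delta> F u v}"

text \<open>The points \<open>x\<close> and \<open>y\<close> are lifted through \<open>G\<close> by
  the intermediate value theorem, the second lift to the right of the first. If \<open>G\<close>
  runs downwards, \<open>y\<close> is met before \<open>x\<close>, and the symmetry of
  \<open>returns\<close> lets them exchange roles.\<close>

lemma returns_compose:
  assumes G: "continuous_on {c..d} G" and "c \<le> d"
    and ret: "returns \<delta> F (min (G c) (G d)) (max (G c) (G d))"
  shows "returns \<delta> (\<lambda>x. F (G x)) c d"
proof (cases "G c \<le> G d")
  case True
  then obtain x y where xy: "G c \<le> x" "x \<le> y" "y \<le> G d" "\<bar>F x - F (G d)\<bar> < \<delta>" "\<bar>F y - F (G c)\<bar> < \<delta>"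
    using ret by (auto simp: returns_def min_def max_def)
  obtain x' where x': "c \<le> x'" "x' \<le> d" "G x' = x"
    using IVT'[of G c x d] G xy \<open>c \<le> d\<close> by auto
  have "continuous_on {x'..d} G"
    using G x' by (auto intro: continuous_on_subset)
  then obtain y' where y': "x' \<le> y'" "y' \<le> d" "G y' = y"
    using IVT'[of G x' y d] xy x' by auto
  show ?thesis
    unfolding returns_def by (rule exI[of _ x'], rule exI[of _ y']) (use xy x' y' in auto)
next
  case False
  then obtain x y where xy: "G d \<le> x" "x \<le> y" "y \<le> G c" "\<bar>F x - F (G c)\<bar> < \<delta>" "\<bar>F y - F (G d)\<bar> < \<delta>"
    using ret by (auto simp: returns_def min_def max_def)
  obtain y' where y': "c \<le> y'" "y' \<le> d" "G y' = y"
    using IVT2'[of G d y c] G xy \<open>c \<le> d\<close> by auto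
  have "continuous_on {y'..d} G"
    using G y' by (auto intro: continuous_on_subset)
  then obtain x' where x': "y' \<le> x'" "x' \<le> d" "G x' = x"
    using IVT2'[of G d x y'] xy y' by auto
  show ?thesis
    unfolding returns_def by (rule exI[of _ y'], rule exI[of _ x']) (use xy x' y' in auto)
qed

lemma returns_cong:
  assumes "\<And>x. c \<le> x \<Longrightarrow> x \<le> d \<Longrightarrow> F x = G x" "c \<le> d"
  shows "returns \<delta> F c d \<longleftrightarrow> returns \<delta> G c d"
proof -
  have "returns \<delta> G c d" if "returns \<delta> F c d" "\<And>x. c \<le> x \<Longrightarrow> x \<le> d \<Longrightarrow> F x = G x"
    for F G :: "real \<Rightarrow> real"
  proof -
    from that(1) obtain x y where
      "c \<le> x" "x \<le> y" "y \<le> d" "\<bar>F x - F d\<bar> < \<delta>" "\<bar>F y - F c\<bar> < \<delta>"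
      by (auto simp: returns_def)
    then show ?thesis
      unfolding returns_def using that(2)[of x] that(2)[of y] that(2)[of c] that(2)[of d] \<open>c \<le> d\<close>
      by (intro exI[of _ x] exI[of _ y]) auto
  qed
  from this[of F G] this[of G F] show ?thesis
    using assms by auto
qed

lemma segment_value:
  fixes F :: "real \<Rightarrow> real"
  assumes "continuous_on I01 F" "x \<in> I01" "y \<in> I01" "m \<in> closed_segment (F x) (F y)"
  shows "\<exists>z\<in>closed_segment x y. F z = m"
proof -
  have "closed_segment x y \<subseteq> I01"
    using assms by (simp add: closed_segment_subset)
  then have "connected (F ` closed_segment x y)"
    using assms(1) by (intro connected_continuous_image) (auto intro: continuous_on_subset)
  then have "convex (F ` closed_segment x y)"
    by (simp add: is_interval_connected_1 is_interval_convex_1[symmetric])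
  then have "closed_segment (F x) (F y) \<subseteq> F ` closed_segment x y"
    by (intro closed_segment_subset) auto
  then show ?thesis using assms(4) by auto
qed

lemma strictly_between_value:
  fixes F :: "real \<Rightarrow> real"
  assumes F: "continuous_on I01 F" and "x \<in> I01" "y \<in> I01" and "F x < m" "m < F y"
  shows "\<exists>z. min x y < z \<and> z < max x y \<and> F z = m"
proof -
  obtain z where "z \<in> closed_segment x y" "F z = m"
    using segment_value[of F x y m] assms by (auto simp: closed_segment_eq_real_ivl)
  moreover from this have "z \<noteq> x" "z \<noteq> y" using assms by auto
  ultimately show ?thesis
    by (intro exI[of _ z]) (auto simp: closed_segment_eq_real_ivl split: if_splits)
qed

lemma crossing_range:
  assumes F: "continuous_on I01 F" and "a \<noteq> b" and cr: "crossing F a b u v"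
    and x: "u \<le> x" "x \<le> v"
  shows "min a b \<le> F x \<and> F x \<le> max a b"
proof (rule ccontr)
  have uv: "0 \<le> u" "u < v" "v \<le> 1" "{F u, F v} = {a, b}"
    and inner: "\<And>y. u < y \<Longrightarrow> y < v \<Longrightarrow> F y \<noteq> a \<and> F y \<noteq> b"
    using cr by (auto simp: crossing_def)
  have ends: "F u = a \<and> F v = b \<or> F u = b \<and> F v = a"
    using uv(4) by (auto simp: doubleton_eq_iff)
  obtain e where e: "e = u \<or> e = v" "F e = max a b"
    using ends by (metis max_def)
  obtain e' where e': "e' = u \<or> e' = v" "F e' = min a b"
    using ends by (metis min_def)
  have I: "x \<in> I01" "e \<in> I01" "e' \<in> I01" using e e' uv x by auto
  assume "\<not> ?thesis"
  then consider "F x < min a b" | "F x > max a b" by linarith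
  \<comment> \<open>The way from \<open>x\<close> to the endpoint at the opposite level passes the
    nearer level strictly inside the crossing.\<close>
  then obtain y where "u < y" "y < v" "F y = a \<or> F y = b"
  proof cases
    case 1
    then obtain y where "min x e < y" "y < max x e" "F y = min a b"
      using strictly_between_value[OF F I(1,2), of "min a b"] e \<open>a \<noteq> b\<close> by (auto simp: min_def max_def split: if_splits)
    then show ?thesis using that[of y] x e uv by (auto simp: min_def max_def split: if_splits)
  next
    case 2
    then obtain y where "min e' x < y" "y < max e' x" "F y = max a b"
      using strictly_between_value[OF F I(3,1), of "max a b"] e' \<open>a \<noteq> b\<close> by (auto simp: min_def max_def split: if_splits)
    then show ?thesis using that[of y] x e' uv by (auto simp: min_def max_def split: if_splits)
  qed
  then show False using inner by blast
qed

text \<open>\<open>F\<close> is \<open>a\<close> or \<open>b\<close> at the ends of a crossing, so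
  no end of one lies strictly inside the other.\<close>

lemma crossing_disjoint:
  assumes "crossing F a b u v" "crossing F a b u' v'"
  shows "u = u' \<and> v = v' \<or> v \<le> u' \<or> v' \<le> u"
proof (rule ccontr)
  assume *: "\<not> ?thesis"
  have "F u \<in> {a, b}" "F v \<in> {a, b}" "F u' \<in> {a, b}" "F v' \<in> {a, b}"
    and "\<And>x. u < x \<Longrightarrow> x < v \<Longrightarrow> F x \<notin> {a, b}" "\<And>x. u' < x \<Longrightarrow> x < v' \<Longrightarrow> F x \<notin> {a, b}"
    and "u < v" "u' < v'"
    using assms unfolding crossing_def by blast+
  then have "\<not> (u < u')" "\<not> (u' < u)" "\<not> (v < v')" "\<not> (v' < v)"
    using * by (meson not_le less_trans)+
  with * show False by auto
qed

text \<open>\<open>F\<close> changes by \<open>\<bar>a - b\<bar>\<close> over a crossing, so by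
  uniform continuity all crossings have at least some length \<kappa>. As they do not overlap, their
  left ends lie in different cells of a grid of mesh \<kappa>.\<close>

lemma finite_crossings:
  assumes F: "continuous_on I01 F" and "a \<noteq> b"
  shows "finite {(u, v). crossing F a b u v}"
proof -
  have "uniformly_continuous_on I01 F"
    using F by (simp add: compact_uniformly_continuous)
  then obtain \<kappa> where "\<kappa> > 0" and
    \<kappa>: "\<And>x y. x \<in> I01 \<Longrightarrow> y \<in> I01 \<Longrightarrow> \<bar>y - x\<bar> < \<kappa> \<Longrightarrow> \<bar>F y - F x\<bar> < \<bar>a - b\<bar>"
    using \<open>a \<noteq> b\<close> unfolding uniformly_continuous_on_def dist_real_def
    by (metis zero_less_abs_iff right_minus_eq)
  have long: "v - u \<ge> \<kappa>" if cr: "crossing F a b u v" for u v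
  proof (rule ccontr)
    assume "\<not> v - u \<ge> \<kappa>"
    then have "\<bar>F v - F u\<bar> < \<bar>a - b\<bar>"
      using cr by (intro \<kappa>) (auto simp: crossing_def)
    moreover have "\<bar>F v - F u\<bar> = \<bar>a - b\<bar>"
      using cr by (auto simp: crossing_def doubleton_eq_iff)
    ultimately show False by simp
  qed
  define C where "C = {(u, v). crossing F a b u v}"
  have "inj_on (\<lambda>(u, v). \<lfloor>u / \<kappa>\<rfloor>) C"
  proof (rule inj_onI, clarify)
    fix u v u' v'
    assume C: "(u, v) \<in> C" "(u', v') \<in> C" and "\<lfloor>u / \<kappa>\<rfloor> = \<lfloor>u' / \<kappa>\<rfloor>"
    then have "\<bar>u / \<kappa> - u' / \<kappa>\<bar> < 1" by linarith
    then have "\<bar>u - u'\<bar> < \<kappa>"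
      using \<open>\<kappa> > 0\<close> by (simp add: field_simps flip: diff_divide_distrib)
    then show "u = u' \<and> v = v'"
      using crossing_disjoint[of F a b u v u' v'] long[of u v] long[of u' v'] C
      by (auto simp: C_def)
  qed
  moreover have "(\<lambda>(u, v). \<lfloor>u / \<kappa>\<rfloor>) ` C \<subseteq> {0..\<lfloor>1 / \<kappa>\<rfloor>}"
  proof clarify
    fix u v assume "(u, v) \<in> C"
    then have "0 \<le> u" "u \<le> 1" by (auto simp: C_def crossing_def)
    then have "0 \<le> u / \<kappa>" "u / \<kappa> \<le> 1 / \<kappa>"
      using \<open>\<kappa> > 0\<close> by (auto simp: divide_right_mono)
    then show "\<lfloor>u / \<kappa>\<rfloor> \<in> {0..\<lfloor>1 / \<kappa>\<rfloor>}" by (auto intro: floor_mono)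
  qed
  ultimately have "finite C"
    by (meson finite_atLeastAtMost_int finite_imageD finite_subset)
  then show ?thesis by (simp add: C_def)
qed

lemma crossing_between:
  assumes F: "continuous_on I01 F" and "0 \<le> c" "c < d" "d \<le> 1" and ends: "{F c, F d} = {a, b}" "a \<noteq> b"
  obtains u v where "c \<le> u" "v \<le> d" "F u = F c" "F v = F d" "crossing F a b u v"
proof -
  have Fcd: "continuous_on {c..d} F"
    using F assms by (auto intro: continuous_on_subset)
  \<comment> \<open>Take \<open>v\<close> as the leftmost point with value \<open>F d\<close> and
    \<open>u\<close> as the last point before \<open>v\<close> with value \<open>F c\<close>;
    neither value can recur in between.\<close>
  define B where "B = {x \<in> {c..d}. F x = F d}"
  have "closed B"
    using Fcd unfolding B_def by (rule continuous_closed_preimage_constant) simp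
  moreover have "bounded B"
    by (rule bounded_subset[of "{c..d}"]) (auto simp: B_def)
  ultimately have "compact B" by (simp add: compact_eq_bounded_closed)
  moreover have "d \<in> B" using assms by (auto simp: B_def)
  ultimately obtain v where v: "v \<in> B" "\<And>x. x \<in> B \<Longrightarrow> v \<le> x"
    using compact_attains_inf[of B] by blast
  have Fcv: "continuous_on {c..v} F"
    using Fcd v by (auto intro: continuous_on_subset simp: B_def)
  define A where "A = {x \<in> {c..v}. F x = F c}"
  have "closed A"
    using Fcv unfolding A_def by (rule continuous_closed_preimage_constant) simp
  moreover have "bounded A"
    by (rule bounded_subset[of "{c..v}"]) (auto simp: A_def)
  ultimately have "compact A" by (simp add: compact_eq_bounded_closed)
  moreover have "c \<in> A" using v assms by (auto simp: A_def B_def)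
  ultimately obtain u where u: "u \<in> A" "\<And>x. x \<in> A \<Longrightarrow> x \<le> u"
    using compact_attains_sup[of A] by blast
  have "F u = F c" "F v = F d" "c \<le> u" "u \<le> v" "v \<le> d"
    using u v by (auto simp: A_def B_def)
  moreover have "F c \<noteq> F d" using ends by (auto simp: doubleton_eq_iff)
  moreover have "F x \<noteq> F c \<and> F x \<noteq> F d" if "u < x" "x < v" for x
  proof -
    have "x \<notin> A" "x \<notin> B" using u(2) v(2) that by (meson not_le)+
    then show ?thesis using that \<open>v \<le> d\<close> \<open>c \<le> u\<close> by (auto simp: A_def B_def)
  qed
  moreover from calculation have "u < v" by (metis order_le_less)
  ultimately have "crossing F a b u v"
    using assms by (auto simp: crossing_def)
  then show thesis
    using that \<open>F u = F c\<close> \<open>F v = F d\<close> \<open>c \<le> u\<close> \<open>v \<le> d\<close> by blast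
qed

lemma returns_mono:
  assumes "returns \<delta> F u v" "c \<le> u" "v \<le> d" "F u = F c" "F v = F d"
  shows "returns \<delta> F c d"
proof -
  obtain x y where "u \<le> x" "x \<le> y" "y \<le> v" "\<bar>F x - F v\<bar> < \<delta>" "\<bar>F y - F u\<bar> < \<delta>"
    using assms(1) by (auto simp: returns_def)
  then show ?thesis
    using assms unfolding returns_def by (intro exI[of _ x] exI[of _ y]) auto
qed

text \<open>Since \<open>G\<close> never runs backwards over a bad crossing of \<open>P\<close>, the bad crossings of \<open>Q\<close> are mapped
  injectively to those of \<open>P\<close>, and \<open>(u, v)\<close> is not hit.\<close>

lemma card_bad_crossings_less:
  assumes "a \<noteq> b" and P: "continuous_on I01 P" and Q: "continuous_on I01 Q"
    and G: "continuous_on I01 G" "G ` I01 \<subseteq> I01"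
    and QP: "\<And>x. x \<in> I01 \<Longrightarrow> min a b \<le> Q x \<Longrightarrow> Q x = P (G x)"
    and no_drop: "\<And>x y s t. 0 \<le> x \<Longrightarrow> x < y \<Longrightarrow> y \<le> 1 \<Longrightarrow> (s, t) \<in> bad_crossings \<delta> P a b \<Longrightarrow>
      G x = t \<Longrightarrow> G y = s \<Longrightarrow> False"
    and uv: "(u, v) \<in> bad_crossings \<delta> P a b"
    and repaired: "\<And>c d. 0 \<le> c \<Longrightarrow> c < d \<Longrightarrow> d \<le> 1 \<Longrightarrow> G c = u \<Longrightarrow> G d = v \<Longrightarrow> returns \<delta> Q c d"
  shows "card (bad_crossings \<delta> Q a b) < card (bad_crossings \<delta> P a b)"
proof -
  have image: "(G c, G d) \<in> bad_crossings \<delta> P a b" if cd: "(c, d) \<in> bad_crossings \<delta> Q a b" for c d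
  proof -
    have cr: "crossing Q a b c d" and nr: "\<not> returns \<delta> Q c d"
      using cd by (auto simp: bad_crossings_def)
    have cd': "0 \<le> c" "c < d" "d \<le> 1" "{Q c, Q d} = {a, b}"
      using cr by (auto simp: crossing_def)
    \<comment> \<open>On a crossing \<open>Q\<close> does not fall below \<open>min a b\<close>, and
      there it factors through \<open>G\<close>.\<close>
    have Q_eq: "Q x = P (G x)" if "c \<le> x" "x \<le> d" for x
      using crossing_range[OF Q \<open>a \<noteq> b\<close> cr that] QP that cd' by auto
    define s t where "s = min (G c) (G d)" and "t = max (G c) (G d)"
    have Gcd: "G c \<in> I01" "G d \<in> I01" using G(2) cd'(1-3) by (auto simp: image_subset_iff)
    have ab: "{P (G c), P (G d)} = {a, b}" using cd' Q_eq[of c] Q_eq[of d] by auto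
    then have "G c \<noteq> G d" using \<open>a \<noteq> b\<close> by (auto simp: doubleton_eq_iff)
    have "P y \<noteq> a \<and> P y \<noteq> b" if y: "s < y" "y < t" for y
    proof -
      obtain x where "c < x" "x < d" "G x = y"
      proof (cases "G c < G d")
        case True
        then have "G c < y" "y < G d" using y by (auto simp: s_def t_def)
        from strictly_between_value[OF G(1) _ _ this] cd' that show ?thesis by auto
      next
        case False
        then have "G d < y" "y < G c" using y by (auto simp: s_def t_def)
        from strictly_between_value[OF G(1) _ _ this] cd' that show ?thesis by auto
      qed
      then show ?thesis using cr Q_eq[of x] by (auto simp: crossing_def)
    qed
    then have "crossing P a b s t"
      using Gcd \<open>G c \<noteq> G d\<close> ab by (auto simp: crossing_def s_def t_def min_def max_def insert_commute)
    moreover have "\<not> returns \<delta> P s t"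
    proof
      assume "returns \<delta> P s t"
      then have "returns \<delta> (\<lambda>x. P (G x)) c d"
        unfolding s_def t_def using cd'(1-3)
        by - (rule returns_compose[OF continuous_on_subset[OF G(1)]], auto)
      then show False using nr returns_cong[of c d Q "\<lambda>x. P (G x)" \<delta>, OF Q_eq] cd' by simp
    qed
    ultimately have st: "(s, t) \<in> bad_crossings \<delta> P a b" by (auto simp: bad_crossings_def)
    have "G c < G d"
    proof (rule ccontr)
      assume "\<not> ?thesis"
      then have "G c = t" "G d = s" by (auto simp: s_def t_def)
      then show False using no_drop[OF _ _ _ st] cd' by blast
    qed
    then show ?thesis using st by (auto simp: s_def t_def min_def max_def)
  qed
  \<comment> \<open>Of two disjoint bad crossings with the same image (s, t), the left one ends with
    \<open>G\<close> at t and the right one begins with \<open>G\<close> at s: a drop over (s,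
    t).\<close>
  have inj: "inj_on (\<lambda>(c, d). (G c, G d)) (bad_crossings \<delta> Q a b)"
  proof (rule inj_onI, clarify)
    fix c d c' d'
    assume 1: "(c, d) \<in> bad_crossings \<delta> Q a b" and 2: "(c', d') \<in> bad_crossings \<delta> Q a b"
      and eq: "G c = G c'" "G d = G d'"
    have cr: "crossing Q a b c d" "crossing Q a b c' d'"
      using 1 2 by (auto simp: bad_crossings_def)
    have st: "(G c, G d) \<in> bad_crossings \<delta> P a b" by (rule image[OF 1])
    then have "G c < G d" by (auto simp: bad_crossings_def crossing_def)
    have "\<not> d < c'" using no_drop[OF _ _ _ st, of d c'] eq cr by (auto simp: crossing_def)
    moreover have "\<not> d' < c" using no_drop[OF _ _ _ st, of d' c] eq cr by (auto simp: crossing_def)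
    moreover have "d \<noteq> c'" "d' \<noteq> c" using \<open>G c < G d\<close> eq by auto
    ultimately show "c = c' \<and> d = d'"
      using crossing_disjoint[OF cr] by linarith
  qed
  have "(\<lambda>(c, d). (G c, G d)) ` bad_crossings \<delta> Q a b \<subseteq> bad_crossings \<delta> P a b - {(u, v)}"
  proof clarify
    fix c d assume cd: "(c, d) \<in> bad_crossings \<delta> Q a b"
    have "(G c, G d) \<noteq> (u, v)"
      using cd repaired[of c d] by (auto simp: bad_crossings_def crossing_def)
    then show "(G c, G d) \<in> bad_crossings \<delta> P a b - {(u, v)}" using image[OF cd] by auto
  qed
  moreover have fin: "finite (bad_crossings \<delta> P a b)"
    using finite_crossings[OF P \<open>a \<noteq> b\<close>] by (rule rev_finite_subset) (auto simp: bad_crossings_def)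
  ultimately have "card (bad_crossings \<delta> Q a b) \<le> card (bad_crossings \<delta> P a b - {(u, v)})"
    using inj by (metis card_image card_mono finite_Diff)
  also have "\<dots> < card (bad_crossings \<delta> P a b)"
    using uv fin by (intro psubset_card_mono) auto
  finally show ?thesis .
qed

section \<open>Maps pushing every point towards 1\<close>

text \<open>The bound by \<open>2 * sqrt x\<close> controls all iterates near \<open>0\<close> uniformly over the class; its
  infinite slope at \<open>0\<close> leaves room for tents of any relative height.\<close>

definition pushing :: "(real \<Rightarrow> real) \<Rightarrow> bool" where
  "pushing f \<longleftrightarrow> continuous_on I01 f \<and> f ` I01 \<subseteq> I01 \<and> f 1 = 1 \<and>
     (\<forall>x. 0 < x \<and> x < 1 \<longrightarrow> x < f x) \<and> (\<forall>x\<in>I01. f x \<le> 2 * sqrt x)"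

lemma pushing_range:
  assumes "pushing f" "0 \<le> x" "x \<le> 1"
  shows "0 \<le> f x" "f x \<le> 1"
proof -
  have "f x \<in> I01" using assms unfolding pushing_def by (meson atLeastAtMost_iff image_subset_iff)
  then show "0 \<le> f x" "f x \<le> 1" by auto
qed

lemma pushing_le_sqrt: "pushing f \<Longrightarrow> 0 \<le> x \<Longrightarrow> x \<le> 1 \<Longrightarrow> f x \<le> 2 * sqrt x"
  by (auto simp: pushing_def)

lemma pushing_fix: "pushing f \<Longrightarrow> f 0 = 0" "pushing f \<Longrightarrow> f 1 = 1"
  using pushing_range[of f 0] pushing_le_sqrt[of f 0] by (auto simp: pushing_def)

lemma pushing_less: "pushing f \<Longrightarrow> 0 < x \<Longrightarrow> x < 1 \<Longrightarrow> x < f x"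
  by (auto simp: pushing_def)

lemma pushing_ge:
  assumes "pushing f" "0 \<le> x" "x \<le> 1"
  shows "x \<le> f x"
proof (cases "x = 0 \<or> x = 1")
  case True
  then show ?thesis using pushing_fix[OF assms(1)] by auto
next
  case False
  then have "0 < x" "x < 1" using assms by auto
  then show ?thesis using assms(1) by (auto simp: pushing_def intro: less_imp_le)
qed

lemma pushing_iter_range:
  assumes "pushing f" "0 \<le> x" "x \<le> 1"
  shows "0 \<le> (f ^^ n) x \<and> (f ^^ n) x \<le> 1"
  using assms by (induction n) (auto intro: pushing_range)

lemma pushing_iter_fix: "pushing f \<Longrightarrow> (f ^^ n) 0 = 0"
  by (induction n) (auto simp: pushing_fix)

lemma pushing_iter_mono:
  assumes "pushing f" "0 \<le> x" "x \<le> 1" "i \<le> n"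
  shows "(f ^^ i) x \<le> (f ^^ n) x"
  using \<open>i \<le> n\<close>
proof (induction n rule: dec_induct)
  case (step n)
  then show ?case
    using pushing_ge[OF assms(1)] pushing_iter_range[OF assms(1-3), of n] by force
qed simp

lemma pushing_iter_ge: "pushing f \<Longrightarrow> 0 \<le> x \<Longrightarrow> x \<le> 1 \<Longrightarrow> x \<le> (f ^^ n) x"
  using pushing_iter_mono[of f x 0 n] by simp

lemma pushing_iter_continuous:
  assumes "pushing f"
  shows "continuous_on I01 (f ^^ n)"
proof (induction n)
  case (Suc n)
  have "(f ^^ n) ` I01 \<subseteq> I01" using pushing_iter_range[OF assms] by auto
  moreover have "continuous_on I01 f" using assms by (simp add: pushing_def)
  ultimately show ?case
    using Suc by (auto simp: o_def intro: continuous_on_compose2)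
qed (auto simp: id_def)

text \<open>\<epsilon> depends on \<open>n\<close> and \<open>e\<close> alone, so it can be fixed
  before the map to which it is applied has been constructed. In the induction, one application of
  \<open>f\<close> takes values below (e/2)^2 to values below \<open>e\<close>.\<close>

lemma pushing_iter_small:
  assumes "0 < e"
  shows "\<exists>\<epsilon>>0. \<forall>f x. pushing f \<longrightarrow> 0 \<le> x \<longrightarrow> x \<le> 1 \<longrightarrow> x \<le> \<epsilon> \<longrightarrow> (f ^^ n) x < e"
  using assms
proof (induction n arbitrary: e)
  case 0
  then show ?case by (intro exI[of _ "e / 2"]) auto
next
  case (Suc n)
  have "0 < (e / 2)\<^sup>2" using Suc.prems by simp
  from Suc.IH[OF this] obtain \<epsilon> where "\<epsilon> > 0" and
    \<epsilon>: "\<And>f x. pushing f \<Longrightarrow> 0 \<le> x \<Longrightarrow> x \<le> 1 \<Longrightarrow> x \<le> \<epsilon> \<Longrightarrow> (f ^^ n) x < (e / 2)\<^sup>2" by blast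
  have "(f ^^ Suc n) x < e" if fx: "pushing f" "0 \<le> x" "x \<le> 1" "x \<le> \<epsilon>" for f x
  proof -
    have "sqrt ((f ^^ n) x) < e / 2"
      using \<epsilon>[OF fx] Suc.prems by (intro real_less_lsqrt) auto
    moreover have "f ((f ^^ n) x) \<le> 2 * sqrt ((f ^^ n) x)"
      using fx pushing_iter_range[OF fx(1-3)] by (intro pushing_le_sqrt) auto
    ultimately show ?thesis by simp
  qed
  then show ?case using \<open>\<epsilon> > 0\<close> by blast
qed

text \<open>On the compact interval from \<open>e\<close> to \<beta> the displacement
  \<open>f x - x\<close> has a positive minimum, so an orbit gains at least this amount per step
  until it passes \<beta>.\<close>

lemma pushing_iter_large:
  assumes f: "pushing f" and "0 < e" "\<beta> < 1"
  shows "\<exists>n0. \<forall>n\<ge>n0. \<forall>x. e \<le> x \<and> x \<le> 1 \<longrightarrow> \<beta> < (f ^^ n) x"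
proof (cases "e \<le> \<beta>")
  case False
  have "\<beta> < (f ^^ n) x" if "e \<le> x" "x \<le> 1" for n x
    using that False \<open>0 < e\<close> pushing_iter_ge[OF f, of x n] by linarith
  then show ?thesis by blast
next
  case True
  have "continuous_on {e..\<beta>} (\<lambda>x. f x - x)"
    using f assms unfolding pushing_def
    by (intro continuous_intros) (auto intro: continuous_on_subset)
  then have "\<exists>x\<in>{e..\<beta>}. \<forall>y\<in>{e..\<beta>}. f x - x \<le> f y - y"
    using True by (intro continuous_attains_inf) auto
  then obtain x0 where x0: "x0 \<in> {e..\<beta>}" "\<And>x. x \<in> {e..\<beta>} \<Longrightarrow> f x0 - x0 \<le> f x - x"
    by blast
  define m where "m = f x0 - x0"
  have "m > 0" using x0(1) f assms by (auto simp: m_def pushing_def)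
  have grow: "\<beta> < (f ^^ n) x \<or> e + real n * m \<le> (f ^^ n) x" if x: "e \<le> x" "x \<le> 1" for n x
  proof (induction n)
    case (Suc n)
    have r: "0 \<le> (f ^^ n) x" "(f ^^ n) x \<le> 1" "e \<le> (f ^^ n) x"
      using pushing_iter_range[OF f, of x n] pushing_iter_ge[OF f, of x n] x assms by auto
    show ?case
    proof (cases "\<beta> < (f ^^ n) x")
      case True
      then show ?thesis using pushing_ge[OF f r(1,2)] by auto
    next
      case False
      then have "m \<le> f ((f ^^ n) x) - (f ^^ n) x"
        unfolding m_def using r by (intro x0(2)) auto
      then show ?thesis using Suc False by (auto simp: algebra_simps)
    qed
  qed (use x in auto)
  obtain n0 where n0: "1 < real n0 * m" using reals_Archimedean3[OF \<open>m > 0\<close>] by blast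
  have "\<beta> < (f ^^ n) x" if "n \<ge> n0" "e \<le> x" "x \<le> 1" for n x
  proof -
    have "real n0 * m \<le> real n * m" using that \<open>m > 0\<close> by auto
    then show ?thesis
      using grow[OF that(2,3), of n] n0 pushing_iter_range[OF f, of x n] that \<open>0 < e\<close> by linarith
  qed
  then show ?thesis by blast
qed

text \<open>Orbits increase, so one that starts at \<open>p\<close> or higher never enters the
  region where the maps may differ.\<close>

lemma pushing_iter_agree:
  assumes "pushing f" "\<And>x. p \<le> x \<Longrightarrow> x \<le> 1 \<Longrightarrow> g x = f x" "0 \<le> p" "p \<le> x" "x \<le> 1"
  shows "(g ^^ n) x = (f ^^ n) x"
proof (induction n)
  case (Suc n)
  then show ?case
    using assms pushing_iter_ge[OF assms(1), of x n] pushing_iter_range[OF assms(1), of x n] by auto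
qed simp

section \<open>Repairing one crossing\<close>

text \<open>The assumption \<open>high\<close> confines all crossings to the region left of
  \<epsilon>, where \<open>f\<close> doubles. It recurs in the conclusion for
  \<open>\<epsilon>'\<close> and \<open>m\<close>, so that the repair can be repeated.\<close>

lemma repair_crossing:
  assumes f: "pushing f" and tame: "\<And>x. 0 \<le> x \<Longrightarrow> x \<le> \<epsilon> \<Longrightarrow> f x = 2 * x" and "\<epsilon> < 1"
    and ab: "0 < a" "a < 1" "0 < b" "b < 1" "a \<noteq> b" and "0 < \<delta>"
    and high: "\<And>x. \<epsilon> \<le> x \<Longrightarrow> x \<le> 1 \<Longrightarrow> max a b < (f ^^ n) x"
    and bad: "bad_crossings \<delta> (f ^^ n) a b \<noteq> {}"
  obtains g \<epsilon>' m where "pushing g" "0 < \<epsilon>'" "\<epsilon>' \<le> \<epsilon>"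
    "\<And>x. \<epsilon> \<le> x \<Longrightarrow> x \<le> 1 \<Longrightarrow> g x = f x"
    "\<And>x. 0 \<le> x \<Longrightarrow> x \<le> \<epsilon>' \<Longrightarrow> g x = 2 * x"
    "\<And>x. \<epsilon>' \<le> x \<Longrightarrow> x \<le> 1 \<Longrightarrow> max a b < (g ^^ m) x"
    "card (bad_crossings \<delta> (g ^^ m) a b) < card (bad_crossings \<delta> (f ^^ n) a b)"
proof -
  define F where "F = f ^^ n"
  have F: "continuous_on I01 F" unfolding F_def by (rule pushing_iter_continuous[OF f])
  define Bad where "Bad = bad_crossings \<delta> F a b"
  have Bad_bounds: "0 < s \<and> s < t \<and> t < \<epsilon>" if "(s, t) \<in> Bad" for s t
  proof -
    have st: "0 \<le> s" "s < t" "t \<le> 1" "F s \<in> {a, b}" "F t \<in> {a, b}"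
      using that unfolding Bad_def bad_crossings_def crossing_def by blast+
    have "s \<noteq> 0" using st(4) ab pushing_iter_fix[OF f, of n] by (auto simp: F_def)
    moreover have "\<not> \<epsilon> \<le> t" using high[of t] st ab by (auto simp: F_def)
    ultimately show ?thesis using st by auto
  qed
  have "finite Bad"
    using finite_crossings[OF F \<open>a \<noteq> b\<close>] unfolding Bad_def
    by (rule rev_finite_subset) (auto simp: bad_crossings_def)
  have "Bad \<noteq> {}" using bad by (simp add: Bad_def F_def)
  then obtain p where p: "p \<in> Bad" "\<And>q. q \<in> Bad \<Longrightarrow> snd p / fst p \<le> snd q / fst q"
    using arg_min_if_finite[OF \<open>finite Bad\<close>, of "\<lambda>p. snd p / fst p"] by (meson not_less)
  define u v where "u = fst p" and "v = snd p"
  have uv: "(u, v) \<in> Bad" and min_ratio: "\<And>s t. (s, t) \<in> Bad \<Longrightarrow> v / u \<le> t / s"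
    using p(1) p(2)[of "(s, t)" for s t] by (auto simp: u_def v_def)
  have uv': "0 < u" "u < v" "v < \<epsilon>" "v < 1" using Bad_bounds[OF uv] \<open>\<epsilon> < 1\<close> by auto

  have near: "\<exists>d>0. \<forall>x\<in>I01. \<bar>x - y\<bar> < d \<longrightarrow> \<bar>F x - F y\<bar> < \<delta>" if "y \<in> I01" for y
    using F that \<open>0 < \<delta>\<close> unfolding continuous_on_iff dist_real_def by blast
  obtain d1 where d1: "d1 > 0" "\<And>x. x \<in> I01 \<Longrightarrow> \<bar>x - u\<bar> < d1 \<Longrightarrow> \<bar>F x - F u\<bar> < \<delta>"
    using near[of u] uv' by auto
  obtain d2 where d2: "d2 > 0" "\<And>x. x \<in> I01 \<Longrightarrow> \<bar>x - v\<bar> < d2 \<Longrightarrow> \<bar>F x - F v\<bar> < \<delta>"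
    using near[of v] uv' by auto
  \<comment> \<open>By continuity it is enough to climb to \<open>v - \<eta>\<close> and to come
    back to \<open>u + 2 * \<eta>\<close>; the quarter of \<open>v - u\<close> keeps these two
    points in order.\<close>
  define \<eta> where "\<eta> = min (d1 / 3) (min (d2 / 2) ((v - u) / 4))"
  have \<eta>: "0 < \<eta>" "u + 2 * \<eta> < v - \<eta>" "2 * \<eta> < d1" "\<eta> < d2"
    using d1(1) d2(1) uv' by (auto simp: \<eta>_def min_def field_simps)
  obtain e0 where "e0 > 0" and
    e0: "\<And>f x. pushing f \<Longrightarrow> 0 \<le> x \<Longrightarrow> x \<le> 1 \<Longrightarrow> x \<le> e0 \<Longrightarrow> (f ^^ n) x < min a b"
    using pushing_iter_small[of "min a b" n] ab by auto
  \<comment> \<open>Bounds for the scale \<open>z\<close> of the tent: \<open>u / v\<^sup>2\<close>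
    keeps its height below \<open>2 * sqrt x\<close>, \<open>e0\<close> puts it where
    \<open>n\<close> further steps stay below \<open>min a b\<close>, and \<open>u\<close> puts it
    left of the crossing to be repaired.\<close>
  define bnd where "bnd = min (u / v\<^sup>2) (min e0 u)"
  have "bnd > 0" using uv' \<open>e0 > 0\<close> by (auto simp: bnd_def)
  then obtain M0 where "(1/2::real) ^ M0 < bnd"
    using real_arch_pow_inv[of bnd "1/2"] by auto
  \<comment> \<open>A successor, because the step over the tent takes the place of one doubling and
    leaves \<open>M0\<close> of them.\<close>
  define M where "M = Suc M0"
  define z where "z = (1/2::real) ^ M"
  have z: "0 < z" "z \<le> 1/2" "z < bnd"
  proof -
    have "z = (1/2) ^ M0 / 2" "0 < (1/2::real) ^ M0" "(1/2::real) ^ M0 \<le> 1"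
      by (auto simp: z_def M_def power_le_one)
    then show "0 < z" "z \<le> 1/2" "z < bnd" using \<open>(1/2::real) ^ M0 < bnd\<close> by linarith+
  qed
  have zM: "2 ^ M * z = 1" by (simp add: z_def power_one_over)
  have zv: "z * v\<^sup>2 \<le> u" using z uv' by (auto simp: bnd_def field_simps)
  \<comment> \<open>The offset \<eta> at the left foot, like the one in the height, makes the ratio
    of a drop strictly smaller than \<open>v / u\<close>. Since \<open>w2 \<le> 2 * w1\<close>, an
    orbit visits the tent at most once.\<close>
  define w1 w2 wp where "w1 = z * (u + \<eta>)" and "w2 = z * (u + 2 * \<eta>)" and "wp = z * (u + 3/2 * \<eta>)"
  have w: "0 < w1" "w1 < wp" "wp < w2" "w2 \<le> 2 * w1"
    using z uv' \<eta> by (auto simp: w1_def w2_def wp_def)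
  have w2: "w2 \<le> e0" "w2 \<le> u"
  proof -
    have "w2 \<le> z * 1" unfolding w2_def using z uv' \<eta> by (intro mult_left_mono) auto
    then show "w2 \<le> e0" "w2 \<le> u" using z by (auto simp: bnd_def)
  qed
  have "w2 \<le> \<epsilon>"
  proof -
    have "w2 \<le> 1 * (u + 2 * \<eta>)" unfolding w2_def using z uv' \<eta> by (intro mult_right_mono) auto
    then show ?thesis using uv' \<eta> by auto
  qed
  \<comment> \<open>\<open>M0\<close> doublings carry this height to
    \<open>v - \<eta>\<close>.\<close>
  define peak where "peak = 2 * z * (v - \<eta>)"
  have peak: "0 < peak" "peak \<le> 1" "peak \<le> 2 * z * v" "2 * w2 \<le> peak"
  proof -
    show "0 < peak" using z uv' \<eta> by (auto simp: peak_def)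
    have "peak \<le> 1 * (v - \<eta>)" unfolding peak_def using z uv' \<eta> by (intro mult_right_mono) auto
    then show "peak \<le> 1" using uv' \<eta> by auto
    show "peak \<le> 2 * z * v" "2 * w2 \<le> peak" using z uv' \<eta> by (auto simp: peak_def w2_def)
  qed
  define tent where "tent x = peak * (1 - \<bar>x - wp\<bar> / (z * \<eta> / 2))" for x
  have tent_peak: "tent wp = peak" by (simp add: tent_def)
  have tent_le: "tent x \<le> peak" for x
    using peak(1) z \<eta> by (auto simp: tent_def mult_le_cancel_left2)
  have tent_neg: "tent x \<le> 0" if "x \<le> w1 \<or> w2 \<le> x" for x
  proof -
    have "wp - w1 = z * \<eta> / 2" "w2 - wp = z * \<eta> / 2" by (simp_all add: w1_def w2_def wp_def algebra_simps)
    then have "z * \<eta> / 2 \<le> \<bar>x - wp\<bar>" using that by linarith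
    then have "1 \<le> \<bar>x - wp\<bar> / (z * \<eta> / 2)" using z \<eta> by (simp add: field_simps)
    then show ?thesis using peak(1) by (auto simp: tent_def mult_le_0_iff)
  qed
  define g where "g x = max (f x) (tent x)" for x
  have g_out: "g x = f x" if "0 \<le> x" "x \<le> 1" "x \<le> w1 \<or> w2 \<le> x" for x
    using tent_neg[OF that(3)] pushing_range[OF f that(1,2)] by (auto simp: g_def)
  have g: "pushing g"
    unfolding pushing_def
  proof (intro conjI ballI allI impI)
    show "continuous_on I01 g"
      unfolding g_def tent_def using f z \<eta> by (intro continuous_intros) (auto simp: pushing_def)
    show "g ` I01 \<subseteq> I01"
    proof (rule image_subsetI)
      fix x assume "x \<in> I01"
      then show "g x \<in> I01" using pushing_range[OF f, of x] tent_le[of x] peak(2) by (auto simp: g_def)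
    qed
    show "g 1 = 1" using pushing_fix(2)[OF f] tent_le[of 1] peak(2) by (auto simp: g_def)
    show "x < g x" if "0 < x \<and> x < 1" for x
      using f that by (auto simp: g_def pushing_def less_max_iff_disj)
    show "g x \<le> 2 * sqrt x" if "x \<in> I01" for x
    proof (cases "x \<le> w1")
      case True
      then show ?thesis using g_out[of x] pushing_le_sqrt[OF f, of x] that by auto
    next
      case False
      have "z * u < w1" using z \<eta> by (auto simp: w1_def)
      moreover have "(z * v)\<^sup>2 \<le> z * u"
        using mult_left_mono[OF zv, of z] z by (simp add: power2_eq_square mult_ac)
      ultimately have "(z * v)\<^sup>2 \<le> x" using False by simp
      then have "z * v \<le> sqrt x" by (rule real_le_rsqrt)
      then show ?thesis
        using tent_le[of x] peak(3) pushing_le_sqrt[OF f, of x] that by (auto simp: g_def)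
    qed
  qed
  have g_double: "g x = 2 * x" if "0 \<le> x" "x \<le> \<epsilon>" "x \<le> w1 \<or> w2 \<le> x" for x
    using that g_out[of x] tame[of x] \<open>\<epsilon> < 1\<close> by auto
  have g_peak: "g wp = peak"
    using tame[of wp] w \<open>w2 \<le> \<epsilon>\<close> peak(4) tent_peak by (auto simp: g_def)
  have g_iter_double: "(g ^^ k) x = 2 ^ k * x"
    if "0 \<le> x" "\<And>i. i < k \<Longrightarrow> 2 ^ i * x \<le> \<epsilon> \<and> (2 ^ i * x \<le> w1 \<or> w2 \<le> 2 ^ i * x)" for k x
    using that
  proof (induction k)
    case (Suc k)
    then show ?case using g_double[of "2 ^ k * x"] by auto
  qed simp
  \<comment> \<open>As orbits increase, a bound at time \<open>r\<close> keeps the whole orbit in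
    the region where \<open>f\<close> doubles.\<close>
  have g_lower: "2 ^ r * x \<le> (g ^^ r) x" if x: "0 \<le> x" "x \<le> 1" "(g ^^ r) x \<le> \<epsilon>" for r x
    using x(3)
  proof (induction r)
    case (Suc r)
    define y where "y = (g ^^ r) x"
    have y: "0 \<le> y" "y \<le> 1" using pushing_iter_range[OF g x(1,2), of r] by (auto simp: y_def)
    have "g y \<le> \<epsilon>" using Suc.prems by (simp add: y_def)
    then have "y \<le> \<epsilon>" using pushing_ge[OF g y] by simp
    then have "2 * y \<le> g y" using tame[of y] y by (auto simp: g_def)
    moreover have "2 ^ r * x \<le> y" using Suc.IH \<open>y \<le> \<epsilon>\<close> by (simp add: y_def)
    ultimately show ?case by (simp add: y_def)
  qed simp
  \<comment> \<open>Either the orbit misses the tent, or it meets it at a time \<open>j\<close>, is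
    lifted to at most \<open>peak\<close> and only doubles afterwards.\<close>
  have g_upper: "(g ^^ r) x = 2 ^ r * x \<or>
      (\<exists>j<r. w1 < 2 ^ j * x \<and> 2 ^ j * x < w2 \<and> (g ^^ r) x \<le> 2 ^ (r - j) * (z * (v - \<eta>)))"
    if x: "0 \<le> x" "x \<le> 1" "(g ^^ r) x \<le> \<epsilon>" for r x
    using x(3)
  proof (induction r)
    case (Suc r)
    define y where "y = (g ^^ r) x"
    have y: "0 \<le> y" "y \<le> 1" using pushing_iter_range[OF g x(1,2), of r] by (auto simp: y_def)
    have "g y \<le> \<epsilon>" using Suc.prems by (simp add: y_def)
    then have "y \<le> \<epsilon>" using pushing_ge[OF g y] by simp
    have gy: "(g ^^ Suc r) x = g y" by (simp add: y_def)
    from Suc.IH \<open>y \<le> \<epsilon>\<close> consider "y = 2 ^ r * x"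
      | j where "j < r" "w1 < 2 ^ j * x" "2 ^ j * x < w2" "y \<le> 2 ^ (r - j) * (z * (v - \<eta>))"
      unfolding y_def by blast
    then show ?case
    proof cases
      case 1
      show ?thesis
      proof (cases "w1 < y \<and> y < w2")
        case True
        have "g y \<le> peak"
          using tame[OF y(1) \<open>y \<le> \<epsilon>\<close>] tent_le[of y] True peak(4) by (auto simp: g_def)
        then show ?thesis
          using True 1 gy by (intro disjI2 exI[of _ r]) (auto simp: peak_def)
      next
        case False
        then have "g y = 2 * y" using g_double[of y] y \<open>y \<le> \<epsilon>\<close> by auto
        then show ?thesis using 1 gy by simp
      qed
    next
      case (2 j)
      have "2 ^ r * x \<le> y" unfolding y_def by (rule g_lower[OF x(1,2)]) (use \<open>y \<le> \<epsilon>\<close> in \<open>simp add: y_def\<close>)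
      moreover have "2 ^ Suc j * x \<le> 2 ^ r * x"
        using 2(1) x(1) by (intro mult_right_mono power_increasing) auto
      ultimately have "w2 \<le> y" using 2(2) w(4) by simp
      then have "g y = 2 * y" using g_double[of y] y \<open>y \<le> \<epsilon>\<close> by auto
      then show ?thesis
        using 2 gy by (intro disjI2 exI[of _ j]) (auto simp: Suc_diff_le)
    qed
  qed simp

  obtain n0 where n0: "\<And>k x. n0 \<le> k \<Longrightarrow> w1 \<le> x \<Longrightarrow> x \<le> 1 \<Longrightarrow> max a b < (g ^^ k) x"
    using pushing_iter_large[OF g w(1), of "max a b"] ab by auto
  \<comment> \<open>\<open>M\<close> steps bring the tent from scale \<open>z\<close> up to [u, v];
    the further \<open>n0\<close> are there to satisfy \<open>high\<close> with \<open>w1\<close> in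
    the role of \<epsilon>.\<close>
  define r where "r = M + n0"
  define Q where "Q = g ^^ (n + r)"
  have Q: "Q x = (g ^^ n) ((g ^^ r) x)" for x by (simp add: Q_def funpow_add)
  have Q_eq: "Q x = F ((g ^^ r) x)" if "0 \<le> x" "x \<le> 1" "w2 \<le> (g ^^ r) x" for x
    unfolding Q F_def
    using that pushing_iter_range[OF g, of x r] w g_out
    by (intro pushing_iter_agree[OF f, of w2]) auto
  have "card (bad_crossings \<delta> Q a b) < card (bad_crossings \<delta> F a b)"
  proof (rule card_bad_crossings_less[where G = "g ^^ r" and u = u and v = v])
    show "a \<noteq> b" by fact
    show "continuous_on I01 F" by fact
    show "continuous_on I01 Q" "continuous_on I01 (g ^^ r)"
      unfolding Q_def by (rule pushing_iter_continuous[OF g])+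
    show "(g ^^ r) ` I01 \<subseteq> I01" using pushing_iter_range[OF g] by auto
    show "(u, v) \<in> bad_crossings \<delta> F a b" using uv by (simp add: Bad_def)
  next
    \<comment> \<open>What \<open>g ^^ r\<close> leaves at \<open>w2\<close> or lower cannot reach
      \<open>min a b\<close> in \<open>n\<close> more steps; from \<open>w2\<close> on the orbits of
      \<open>g\<close> and \<open>f\<close> coincide.\<close>
    fix x assume x: "x \<in> I01" "min a b \<le> Q x"
    have "\<not> (g ^^ r) x \<le> w2"
      using e0[OF g, of "(g ^^ r) x"] pushing_iter_range[OF g, of x r] x w2(1) by (auto simp: Q)
    then show "Q x = F ((g ^^ r) x)" using Q_eq x by auto
  next
    \<comment> \<open>The drops of \<open>g ^^ r\<close> are strictly inside intervals \<open>2\<^sup>k [u, v]\<close>, while \<open>t / s \<ge> v / u\<close>.\<close>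
    fix x y s t
    assume xy: "0 \<le> x" "x < y" "y \<le> 1" and st: "(s, t) \<in> bad_crossings \<delta> F a b"
      and eq: "(g ^^ r) x = t" "(g ^^ r) y = s"
    have st': "0 < s" "s < t" "t < \<epsilon>" "v / u \<le> t / s"
      using st Bad_bounds[of s t] min_ratio[of s t] by (auto simp: Bad_def)
    have s: "2 ^ r * y \<le> s" using g_lower[of y r] xy st' eq by auto
    have xy': "2 ^ r * x < 2 ^ r * y" using xy by simp
    then have "2 ^ r * x < t" using s st' by linarith
    then obtain j where j: "j < r" "w1 < 2 ^ j * x" "t \<le> 2 ^ (r - j) * (z * (v - \<eta>))"
      using g_upper[of x r] xy st' eq by auto
    define c where "c = 2 ^ (r - j) * z"
    have "c > 0" using z by (simp add: c_def)
    have t: "t \<le> c * (v - \<eta>)" using j(3) by (simp add: c_def)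
    have "c * (u + \<eta>) = 2 ^ (r - j) * w1" by (simp add: c_def w1_def)
    also have "\<dots> \<le> 2 ^ (r - j) * (2 ^ j * x)" using j(2) by simp
    also have "\<dots> = 2 ^ r * x" using j(1) by (simp flip: power_add mult.assoc)
    also have "\<dots> \<le> s" using s xy' by linarith
    finally have s': "c * (u + \<eta>) \<le> s" .
    have "v * s \<le> t * u" using st'(4) st' uv' by (simp add: field_simps)
    also have "\<dots> \<le> c * (v - \<eta>) * u" using t uv' by (intro mult_right_mono) auto
    also have "\<dots> < c * (v * (u + \<eta>))"
      using \<open>c > 0\<close> uv' \<eta> by (auto simp: algebra_simps add_pos_pos)
    also have "\<dots> \<le> v * s" using mult_left_mono[OF s', of v] uv' by (simp add: mult_ac)
    finally show False by simp
  next
    fix c d assume cd: "0 \<le> c" "c < d" "d \<le> 1" "(g ^^ r) c = u" "(g ^^ r) d = v"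
    have c: "2 ^ r * c \<le> u" using g_lower[of c r] cd uv' by auto
    have d: "u + 2 * \<eta> \<le> 2 ^ r * d"
    proof -
      consider "v = 2 ^ r * d" | j where "j < r" "w1 < 2 ^ j * d" "v \<le> 2 ^ (r - j) * (z * (v - \<eta>))"
        using g_upper[of d r] cd uv' by auto
      then show ?thesis
      proof cases
        case 1
        then show ?thesis using \<eta> by simp
      next
        case (2 j)
        \<comment> \<open>\<open>2 ^ (r - j) * z\<close> is a power of two. It exceeds 1, as the
          orbit would otherwise end at \<open>v - \<eta>\<close> or lower, so it is at least
          2.\<close>
        have "2 ^ Suc M \<le> (2::real) ^ (r - j)"
        proof (rule ccontr)
          assume "\<not> ?thesis"
          then have "r - j < Suc M" by (metis linorder_not_le one_le_numeral power_increasing)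
          then have "(2::real) ^ (r - j) * z \<le> 2 ^ M * z" using z by (intro mult_right_mono power_increasing) auto
          then have "2 ^ (r - j) * (z * (v - \<eta>)) \<le> 1 * (v - \<eta>)"
            unfolding zM mult.assoc[symmetric] using uv' \<eta> by (intro mult_right_mono) auto
          then show False using 2(3) \<eta> by simp
        qed
        then have "2 ^ Suc M * w1 \<le> 2 ^ (r - j) * (2 ^ j * d)"
          using 2(2) w(1) by (intro mult_mono) auto
        also have "\<dots> = 2 ^ r * d" using 2(1) by (simp flip: power_add mult.assoc)
        finally have "2 * (2 ^ M * z) * (u + \<eta>) \<le> 2 ^ r * d" by (simp add: w1_def mult_ac)
        then show ?thesis using uv' by (simp add: zM)
      qed
    qed
    have two: "(2::real) ^ r = 2 ^ M * 2 ^ n0" by (simp add: r_def power_add)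
    \<comment> \<open>After \<open>n0\<close> steps \<open>x\<close> is under the peak and
      \<open>y\<close> at the right foot of the tent; the other \<open>M\<close> steps take them to
      \<open>v - \<eta>\<close> and \<open>u + 2 * \<eta>\<close>.\<close>
    define x y where "x = (u + 3/2 * \<eta>) / 2 ^ r" and "y = (u + 2 * \<eta>) / 2 ^ r"
    have xy: "c \<le> x" "x \<le> y" "y \<le> d"
      using c d \<eta> by (auto simp: x_def y_def field_simps)
    have wx: "2 ^ n0 * x = wp" and wy: "2 ^ n0 * y = w2"
      by (auto simp: x_def y_def wp_def w2_def two z_def power_one_over field_simps)
    \<comment> \<open>An orbit of doublings that ends at \<open>w2\<close> or lower was at most at
      \<open>w2 / 2 \<le> w1\<close> before, hence left of the tent.\<close>
    have climb: "(g ^^ n0) s = 2 ^ n0 * s" if s: "0 \<le> s" "2 ^ n0 * s \<le> w2" for s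
    proof (rule g_iter_double[OF s(1)])
      fix i assume "i < n0"
      then have "2 ^ Suc i * s \<le> 2 ^ n0 * s" using s(1) by (intro mult_right_mono power_increasing) auto
      then have "2 * (2 ^ i * s) \<le> 2 * w1" using s(2) w(4) by simp
      then show "2 ^ i * s \<le> \<epsilon> \<and> (2 ^ i * s \<le> w1 \<or> w2 \<le> 2 ^ i * s)"
        using w \<open>w2 \<le> \<epsilon>\<close> by auto
    qed
    have run: "(g ^^ k) s = 2 ^ k * s" if s: "w2 \<le> s" "2 ^ k * s \<le> \<epsilon>" for s k
    proof (rule g_iter_double)
      show "0 \<le> s" using s w by simp
      fix i assume "i < k"
      then have "2 ^ i * s \<le> 2 ^ k * s" using \<open>0 \<le> s\<close> by (intro mult_right_mono power_increasing) auto
      moreover have "1 * s \<le> 2 ^ i * s" using \<open>0 \<le> s\<close> by (intro mult_right_mono one_le_power) auto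
      ultimately show "2 ^ i * s \<le> \<epsilon> \<and> (2 ^ i * s \<le> w1 \<or> w2 \<le> 2 ^ i * s)" using s by auto
    qed
    have gy: "(g ^^ r) y = u + 2 * \<eta>"
    proof -
      have "2 ^ M * w2 = u + 2 * \<eta>" using zM by (simp add: w2_def flip: mult.assoc)
      then have "(g ^^ M) w2 = u + 2 * \<eta>" using run[of w2 M] uv' \<eta> by auto
      moreover have "(g ^^ n0) y = w2" using climb[of y] wy xy cd by auto
      ultimately show ?thesis by (simp add: r_def funpow_add)
    qed
    have gx: "(g ^^ r) x = v - \<eta>"
    proof -
      have "2 ^ M0 * peak = v - \<eta>"
        using zM by (simp add: peak_def M_def flip: mult.assoc)
      then have "(g ^^ M0) peak = v - \<eta>" using run[of peak M0] uv' \<eta> peak(4) w by auto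
      moreover have "(g ^^ n0) x = wp" using climb[of x] wx w xy cd by auto
      moreover have "(g ^^ r) x = (g ^^ M0) ((g ^^ Suc n0) x)"
        unfolding r_def M_def by (simp only: add_Suc add_Suc_right[symmetric] funpow_add o_apply)
      ultimately show ?thesis by (simp add: g_peak)
    qed
    have "Q c = F u" "Q d = F v" "Q x = F (v - \<eta>)" "Q y = F (u + 2 * \<eta>)"
      using Q_eq[of c] Q_eq[of d] Q_eq[of x] Q_eq[of y] cd xy gx gy w2(2) uv' \<eta> by auto
    then show "returns \<delta> Q c d"
      unfolding returns_def using xy d1(2)[of "u + 2 * \<eta>"] d2(2)[of "v - \<eta>"] uv' \<eta>
      by - (rule exI[of _ x], rule exI[of _ y], auto)
  qed
  then show thesis
    using that[of g w1 "n + r"] g w \<open>w2 \<le> \<epsilon>\<close> g_out g_double n0 uv'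
    unfolding Q_def F_def by (auto simp: r_def)
qed

text \<open>Every repair changes the map, \<epsilon> and the exponent, so the induction on the
  number of bad crossings generalises over all three.\<close>

lemma remove_bad_crossings:
  assumes "pushing f" "\<And>x. 0 \<le> x \<Longrightarrow> x \<le> \<epsilon> \<Longrightarrow> f x = 2 * x" "0 < \<epsilon>" "\<epsilon> < 1"
    and ab: "0 < a" "a < 1" "0 < b" "b < 1" "a \<noteq> b" and "0 < \<delta>"
  obtains g \<epsilon>' m where "pushing g" "0 < \<epsilon>'" "\<epsilon>' \<le> \<epsilon>"
    "\<And>x. \<epsilon> \<le> x \<Longrightarrow> x \<le> 1 \<Longrightarrow> g x = f x"
    "\<And>x. 0 \<le> x \<Longrightarrow> x \<le> \<epsilon>' \<Longrightarrow> g x = 2 * x"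
    "bad_crossings \<delta> (g ^^ m) a b = {}"
proof -
  have ind: "\<exists>g \<epsilon>' m. pushing g \<and> 0 < \<epsilon>' \<and> \<epsilon>' \<le> \<epsilon> \<and> (\<forall>x. \<epsilon> \<le> x \<and> x \<le> 1 \<longrightarrow> g x = f x) \<and>
      (\<forall>x. 0 \<le> x \<and> x \<le> \<epsilon>' \<longrightarrow> g x = 2 * x) \<and> bad_crossings \<delta> (g ^^ m) a b = {}"
    if "pushing f" "\<And>x. 0 \<le> x \<Longrightarrow> x \<le> \<epsilon> \<Longrightarrow> f x = 2 * x" "0 < \<epsilon>" "\<epsilon> < 1"
      "\<And>x. \<epsilon> \<le> x \<Longrightarrow> x \<le> 1 \<Longrightarrow> max a b < (f ^^ n) x"
    for f \<epsilon> n
    using that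
  proof (induction "card (bad_crossings \<delta> (f ^^ n) a b)" arbitrary: f \<epsilon> n rule: less_induct)
    case less
    show ?case
    proof (cases "bad_crossings \<delta> (f ^^ n) a b = {}")
      case True
      then show ?thesis using less.prems by (intro exI[of _ f] exI[of _ \<epsilon>] exI[of _ n]) auto
    next
      case False
      obtain g \<epsilon>' m where g: "pushing g" "0 < \<epsilon>'" "\<epsilon>' \<le> \<epsilon>"
        "\<And>x. \<epsilon> \<le> x \<Longrightarrow> x \<le> 1 \<Longrightarrow> g x = f x"
        "\<And>x. 0 \<le> x \<Longrightarrow> x \<le> \<epsilon>' \<Longrightarrow> g x = 2 * x"
        "\<And>x. \<epsilon>' \<le> x \<Longrightarrow> x \<le> 1 \<Longrightarrow> max a b < (g ^^ m) x"
        "card (bad_crossings \<delta> (g ^^ m) a b) < card (bad_crossings \<delta> (f ^^ n) a b)"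
        using repair_crossing[OF less.prems(1,2,4) ab \<open>0 < \<delta>\<close> less.prems(5) False] by blast
      have "\<epsilon>' < 1" using g(3) less.prems(4) by simp
      then obtain h \<epsilon>'' k where h: "pushing h" "0 < \<epsilon>''" "\<epsilon>'' \<le> \<epsilon>'"
        "\<And>x. \<epsilon>' \<le> x \<Longrightarrow> x \<le> 1 \<Longrightarrow> h x = g x"
        "\<And>x. 0 \<le> x \<Longrightarrow> x \<le> \<epsilon>'' \<Longrightarrow> h x = 2 * x" "bad_crossings \<delta> (h ^^ k) a b = {}"
        using less.hyps[OF g(7,1,5,2) _ g(6)] by blast
      have "h x = f x" if "\<epsilon> \<le> x" "x \<le> 1" for x
        using h(4)[of x] g(4)[of x] g(3) that by simp
      moreover have "\<epsilon>'' \<le> \<epsilon>" using h(3) g(3) by simp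
      ultimately show ?thesis using h by blast
    qed
  qed
  obtain n where "\<And>x. \<epsilon> \<le> x \<Longrightarrow> x \<le> 1 \<Longrightarrow> max a b < (f ^^ n) x"
    using pushing_iter_large[OF assms(1,3), of "max a b"] ab by auto
  from ind[OF assms(1-4) this] that show thesis by blast
qed

text \<open>The last clause is what survives in the limit: on a crossing the iterate of
  \<open>h\<close> is at least \<open>min a b\<close>, so the crossing lies right of
  \<open>\<epsilon>'\<close>, where the orbits of \<open>h\<close> and \<open>g\<close> coincide.
  Halving \<epsilon> makes the regions of later changes shrink to 0.\<close>

lemma crooked_approximation:
  assumes "pushing f" "\<And>x. 0 \<le> x \<Longrightarrow> x \<le> \<epsilon> \<Longrightarrow> f x = 2 * x" "0 < \<epsilon>" "\<epsilon> < 1"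
    and ab: "0 < a" "a < 1" "0 < b" "b < 1" "a \<noteq> b" and "0 < \<delta>"
  obtains g \<epsilon>' m where "pushing g" "0 < \<epsilon>'" "\<epsilon>' \<le> \<epsilon> / 2"
    "\<And>x. \<epsilon> \<le> x \<Longrightarrow> x \<le> 1 \<Longrightarrow> g x = f x"
    "\<And>x. 0 \<le> x \<Longrightarrow> x \<le> \<epsilon>' \<Longrightarrow> g x = 2 * x"
    "\<And>h. pushing h \<Longrightarrow> (\<And>x. \<epsilon>' \<le> x \<Longrightarrow> x \<le> 1 \<Longrightarrow> h x = g x) \<Longrightarrow>
      bad_crossings \<delta> (h ^^ m) a b = {}"
proof -
  obtain g \<epsilon>1 m where g: "pushing g" "0 < \<epsilon>1" "\<epsilon>1 \<le> \<epsilon>"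
    "\<And>x. \<epsilon> \<le> x \<Longrightarrow> x \<le> 1 \<Longrightarrow> g x = f x"
    "\<And>x. 0 \<le> x \<Longrightarrow> x \<le> \<epsilon>1 \<Longrightarrow> g x = 2 * x"
    "bad_crossings \<delta> (g ^^ m) a b = {}"
    using remove_bad_crossings[OF assms] by blast
  obtain \<epsilon>2 where "\<epsilon>2 > 0" and
    \<epsilon>2: "\<And>h x. pushing h \<Longrightarrow> 0 \<le> x \<Longrightarrow> x \<le> 1 \<Longrightarrow> x \<le> \<epsilon>2 \<Longrightarrow> (h ^^ m) x < min a b"
    using pushing_iter_small[of "min a b" m] ab by auto
  define \<epsilon>' where "\<epsilon>' = min \<epsilon>2 (\<epsilon>1 / 2)"
  have \<epsilon>': "0 < \<epsilon>'" "\<epsilon>' \<le> \<epsilon>2" "\<epsilon>' \<le> \<epsilon>1 / 2"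
    using \<open>\<epsilon>2 > 0\<close> g(2) by (auto simp: \<epsilon>'_def)
  have "bad_crossings \<delta> (h ^^ m) a b = {}"
    if h: "pushing h" "\<And>x. \<epsilon>' \<le> x \<Longrightarrow> x \<le> 1 \<Longrightarrow> h x = g x" for h
  proof -
    have False if uv: "(u, v) \<in> bad_crossings \<delta> (h ^^ m) a b" for u v
    proof -
      have cr: "crossing (h ^^ m) a b u v" and nr: "\<not> returns \<delta> (h ^^ m) u v"
        using uv by (auto simp: bad_crossings_def)
      have uv': "0 \<le> u" "u < v" "v \<le> 1" using cr by (auto simp: crossing_def)
      have eq: "(h ^^ m) x = (g ^^ m) x" if "u \<le> x" "x \<le> v" for x
      proof -
        have "min a b \<le> (h ^^ m) x"
          using crossing_range[OF pushing_iter_continuous[OF h(1)] \<open>a \<noteq> b\<close> cr that] by simp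
        then have "\<epsilon>' \<le> x" using \<epsilon>2[OF h(1), of x] \<epsilon>' that uv' by linarith
        then show ?thesis
          using pushing_iter_agree[OF g(1) h(2)] \<epsilon>' that uv' by simp
      qed
      have "crossing (g ^^ m) a b u v"
        using cr eq uv' by (simp add: crossing_def)
      moreover have "\<not> returns \<delta> (g ^^ m) u v"
        using nr returns_cong[OF eq] uv' by simp
      ultimately show False using g(6) by (auto simp: bad_crossings_def)
    qed
    then show ?thesis by auto
  qed
  moreover have "\<epsilon>' \<le> \<epsilon> / 2" using \<epsilon>' g(3) by simp
  moreover have "g x = 2 * x" if "0 \<le> x" "x \<le> \<epsilon>'" for x using g(2,5) \<epsilon>' that by simp
  ultimately show thesis using that[of g \<epsilon>' m] g \<epsilon>' by blast
qed

section \<open>Crooked maps\<close>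

lemma returns_if_no_bad_crossings:
  assumes "continuous_on I01 F" "a \<noteq> b" "bad_crossings \<delta> F a b = {}"
    "0 \<le> c" "c < d" "d \<le> 1" "{F c, F d} = {a, b}"
  shows "returns \<delta> F c d"
proof -
  obtain u v where "c \<le> u" "v \<le> d" "F u = F c" "F v = F d" "crossing F a b u v"
    using crossing_between[OF assms(1,4-7,2)] by blast
  moreover from this have "returns \<delta> F u v"
    using assms(3) by (auto simp: bad_crossings_def)
  ultimately show ?thesis by (auto intro: returns_mono)
qed

text \<open>The later iterate factors through \<open>f ^^ (n - m)\<close>, and returns lift through
  this factor. Hence several pairs of levels can share one exponent.\<close>

lemma returns_later_iterate:
  assumes f: "pushing f" and "m \<le> n" "a \<noteq> b" "bad_crossings \<delta> (f ^^ m) a b = {}"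
    and cd: "0 \<le> c" "c < d" "d \<le> 1" "{(f ^^ n) c, (f ^^ n) d} = {a, b}"
  shows "returns \<delta> (f ^^ n) c d"
proof -
  define G where "G = f ^^ (n - m)"
  have n: "f ^^ n = (\<lambda>x. (f ^^ m) (G x))"
    using funpow_add[of m "n - m" f] \<open>m \<le> n\<close> by (simp add: G_def o_def)
  have G: "0 \<le> G x" "G x \<le> 1" if "0 \<le> x" "x \<le> 1" for x
    using pushing_iter_range[OF f that] by (auto simp: G_def)
  have ab: "{(f ^^ m) (G c), (f ^^ m) (G d)} = {a, b}" using cd(4) by (simp add: n)
  then have "G c \<noteq> G d" using \<open>a \<noteq> b\<close> by (auto simp: doubleton_eq_iff)
  moreover have "{(f ^^ m) (min (G c) (G d)), (f ^^ m) (max (G c) (G d))} = {a, b}"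
    using ab by (auto simp: min_def max_def insert_commute)
  ultimately have "returns \<delta> (f ^^ m) (min (G c) (G d)) (max (G c) (G d))"
    using G[of c] G[of d] cd assms
    by (intro returns_if_no_bad_crossings[of _ a b] pushing_iter_continuous[OF f]) (auto simp: min_def max_def)
  moreover have "continuous_on {c..d} G"
    unfolding G_def by (rule continuous_on_subset[OF pushing_iter_continuous[OF f]]) (use cd in auto)
  ultimately show ?thesis
    unfolding n using cd(2) by - (rule returns_compose, auto)
qed

lemma grid_points_between:
  assumes "0 \<le> a" "b \<le> 1" "4 / real N < b - a" "0 < N"
  obtains i j where "0 < i" "i < j" "j < N"
    "a < real i / real N" "real i / real N \<le> a + 1 / real N"
    "b - 1 / real N \<le> real j / real N" "real j / real N < b"
proof -
  \<comment> \<open>The grid points next to \<open>a\<close> and \<open>b\<close> strictly between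
    them, so that the levels 0 and 1 are avoided even if \<open>a = 0\<close> or
    \<open>b = 1\<close>.\<close>
  define i j where "i = nat \<lfloor>a * real N\<rfloor> + 1" and "j = nat (\<lceil>b * real N\<rceil> - 1)"
  have aN: "0 \<le> a * real N" "4 < b * real N - a * real N" "b * real N \<le> real N"
    using assms by (auto simp: field_simps mult_le_cancel_right1)
  have i: "a * real N < real i" "real i \<le> a * real N + 1"
    using aN(1) unfolding i_def by linarith+
  have j: "b * real N - 1 \<le> real j" "real j < b * real N"
    using aN unfolding j_def by linarith+
  show thesis
  proof (rule that[of i j])
    show "0 < i" by (simp add: i_def)
    show "i < j" "j < N" using i j aN by linarith+
    have "a + 1 / real N = (a * real N + 1) / real N" "b - 1 / real N = (b * real N - 1) / real N"
      using assms(4) by (simp_all add: add_divide_distrib diff_divide_distrib)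
    then show "real i / real N \<le> a + 1 / real N" "b - 1 / real N \<le> real j / real N"
      using i(2) j(1) by (simp_all only: divide_right_mono of_nat_0_le_iff)
    show "a < real i / real N" "real j / real N < b"
      using i(1) j(2) assms(4) by (simp_all add: pos_less_divide_eq pos_divide_less_eq)
  qed
qed

text \<open>Replacing \<open>a\<close> and \<open>b\<close> by grid levels between them costs
  \<open>1 / N\<close>, and so does the return between these levels. The sum is below
  \<open>4 / N\<close>, a gap wide enough to hold two different grid levels.\<close>

lemma delta_crooked_if_returns_on_grid:
  assumes F: "continuous_on I01 F" "F ` I01 \<subseteq> I01" and N: "0 < N" "4 / real N < \<delta>"
    and ret: "\<And>i j c d. 0 < i \<Longrightarrow> i < N \<Longrightarrow> 0 < j \<Longrightarrow> j < N \<Longrightarrow> i \<noteq> j \<Longrightarrow> 0 \<le> c \<Longrightarrow> c < d \<Longrightarrow> d \<le> 1 \<Longrightarrow>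
      {F c, F d} = {real i / real N, real j / real N} \<Longrightarrow> returns (1 / real N) F c d"
  shows "delta_crooked \<delta> F"
  unfolding delta_crooked_def delta_crooked_between_def
proof (intro ballI impI)
  fix a b c d assume I: "a \<in> I01" "b \<in> I01" "c \<in> I01" "d \<in> I01" and ab: "F c = a \<and> F d = b"
  show "\<exists>c'\<in>closed_segment c d. \<exists>d'\<in>closed_segment c' d. \<bar>b - F c'\<bar> < \<delta> \<and> \<bar>a - F d'\<bar> < \<delta>"
  proof (cases "\<bar>a - b\<bar> < \<delta>")
    case True
    then show ?thesis
      using ab by (intro bexI[of _ c] bexI[of _ d]) auto
  next
    case False
    obtain i j where ij: "0 < i" "i < N" "0 < j" "j < N" "i \<noteq> j"
      "\<bar>real i / real N - a\<bar> \<le> 1 / real N" "\<bar>real j / real N - b\<bar> \<le> 1 / real N"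
      "real i / real N \<in> closed_segment a b" "real j / real N \<in> closed_segment (real i / real N) b"
    proof (cases "a < b")
      case True
      then have "4 / real N < b - a" using False N by auto
      then obtain i j where "0 < i" "i < j" "j < N"
        "a < real i / real N" "real i / real N \<le> a + 1 / real N"
        "b - 1 / real N \<le> real j / real N" "real j / real N < b"
        using grid_points_between[of a b N] I N by auto
      moreover from this have "real i / real N \<le> real j / real N" by (simp add: divide_right_mono)
      ultimately show thesis
        by (intro that[of i j]) (auto simp: closed_segment_eq_real_ivl)
    next
      case ab: False
      then have "4 / real N < a - b" using False N by auto
      then obtain i j where "0 < i" "i < j" "j < N"
        "b < real i / real N" "real i / real N \<le> b + 1 / real N"
        "a - 1 / real N \<le> real j / real N" "real j / real N < a"
        using grid_points_between[of b a N] I N by auto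
      moreover from this have "real i / real N \<le> real j / real N" by (simp add: divide_right_mono)
      ultimately show thesis
        by (intro that[of j i]) (auto simp: closed_segment_eq_real_ivl)
    qed
    obtain c1 where c1: "c1 \<in> closed_segment c d" "F c1 = real i / real N"
      using segment_value[OF F(1), of c d "real i / real N"] I ab ij by auto
    have "c1 \<in> I01" using c1(1) I closed_segment_subset[of c I01 d] by auto
    then obtain d1 where d1: "d1 \<in> closed_segment c1 d" "F d1 = real j / real N"
      using segment_value[OF F(1), of c1 d "real j / real N"] I ab ij c1 by auto
    have "d1 \<in> I01" using d1(1) I closed_segment_subset[of c1 I01 d] \<open>c1 \<in> I01\<close> by auto
    have "c1 \<noteq> d1" using c1 d1 ij N by auto
    have "\<exists>c'\<in>closed_segment c d. \<exists>d'\<in>closed_segment c' d.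
      \<bar>F c' - real j / real N\<bar> < 1 / real N \<and> \<bar>F d' - real i / real N\<bar> < 1 / real N"
    proof (cases "c1 < d1")
      case True
      then have "returns (1 / real N) F c1 d1"
        using ret[of i j c1 d1] ij c1 d1 \<open>c1 \<in> I01\<close> \<open>d1 \<in> I01\<close> by auto
      then obtain x y where "c1 \<le> x" "x \<le> y" "y \<le> d1"
        "\<bar>F x - real j / real N\<bar> < 1 / real N" "\<bar>F y - real i / real N\<bar> < 1 / real N"
        using c1 d1 by (auto simp: returns_def)
      then show ?thesis
        using c1(1) d1(1) True
        by - (rule bexI[of _ x], rule bexI[of _ y], auto simp: closed_segment_eq_real_ivl split: if_splits)
    next
      case False
      then have "d1 < c1" using \<open>c1 \<noteq> d1\<close> by simp
      \<comment> \<open>The segment is now traversed from right to left, so the levels and later the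
        two witnesses are exchanged.\<close>
      then have "returns (1 / real N) F d1 c1"
        using ret[of j i d1 c1] ij c1 d1 \<open>c1 \<in> I01\<close> \<open>d1 \<in> I01\<close> by auto
      then obtain x y where "d1 \<le> x" "x \<le> y" "y \<le> c1"
        "\<bar>F x - real i / real N\<bar> < 1 / real N" "\<bar>F y - real j / real N\<bar> < 1 / real N"
        using c1 d1 by (auto simp: returns_def)
      then show ?thesis
        using c1(1) d1(1) \<open>d1 < c1\<close>
        by - (rule bexI[of _ y], rule bexI[of _ x], auto simp: closed_segment_eq_real_ivl split: if_splits)
    qed
    then obtain c' d' where "c' \<in> closed_segment c d" "d' \<in> closed_segment c' d"
      "\<bar>F c' - real j / real N\<bar> < 1 / real N" "\<bar>F d' - real i / real N\<bar> < 1 / real N" by blast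
    moreover have "1 / real N + 1 / real N \<le> 4 / real N" by (simp add: divide_right_mono)
    ultimately show ?thesis
      using ij(6,7) N(2) by - (rule bexI[of _ c'], rule bexI[of _ d'], auto)
  qed
qed

lemma crooked_if_no_bad_crossings:
  assumes f: "pushing f"
    and nb: "\<And>i j N. 0 < i \<Longrightarrow> i < N \<Longrightarrow> 0 < j \<Longrightarrow> j < N \<Longrightarrow> i \<noteq> j \<Longrightarrow>
      \<exists>m. bad_crossings (1 / real N) (f ^^ m) (real i / real N) (real j / real N) = {}"
  shows "crooked f"
  unfolding crooked_def
proof (intro allI impI)
  fix \<delta> :: real assume "\<delta> > 0"
  obtain N where N: "4 / \<delta> < real N" using reals_Archimedean2 by blast
  then have "0 < N" using \<open>\<delta> > 0\<close> by (cases N) (auto simp: field_simps)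
  have "4 / real N < \<delta>" using N \<open>\<delta> > 0\<close> \<open>0 < N\<close> by (simp add: field_simps)
  have "\<forall>p. \<exists>m. 0 < fst p \<and> fst p < N \<and> 0 < snd p \<and> snd p < N \<and> fst p \<noteq> snd p \<longrightarrow>
      bad_crossings (1 / real N) (f ^^ m) (real (fst p) / real N) (real (snd p) / real N) = {}"
    using nb by blast
  then obtain m where m: "\<And>p. 0 < fst p \<Longrightarrow> fst p < N \<Longrightarrow> 0 < snd p \<Longrightarrow> snd p < N \<Longrightarrow> fst p \<noteq> snd p \<Longrightarrow>
      bad_crossings (1 / real N) (f ^^ m p) (real (fst p) / real N) (real (snd p) / real N) = {}"
    by metis
  \<comment> \<open>The sum dominates every \<open>m p\<close>, and the successor ensures
    \<open>n \<ge> 1\<close>.\<close>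
  define n where "n = Suc (\<Sum>p\<in>{..<N} \<times> {..<N}. m p)"
  have "delta_crooked \<delta> (f ^^ n)"
  proof (rule delta_crooked_if_returns_on_grid[OF _ _ \<open>0 < N\<close> \<open>4 / real N < \<delta>\<close>])
    show "continuous_on I01 (f ^^ n)" by (rule pushing_iter_continuous[OF f])
    show "(f ^^ n) ` I01 \<subseteq> I01" using pushing_iter_range[OF f] by auto
    fix i j :: nat and c d :: real
    assume ij: "0 < i" "i < N" "0 < j" "j < N" "i \<noteq> j" and cd: "0 \<le> c" "c < d" "d \<le> 1"
      "{(f ^^ n) c, (f ^^ n) d} = {real i / real N, real j / real N}"
    have "m (i, j) \<le> (\<Sum>p\<in>{..<N} \<times> {..<N}. m p)" using ij by (intro member_le_sum) auto
    then have "m (i, j) \<le> n" by (simp add: n_def)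
    moreover have "real i / real N \<noteq> real j / real N" using ij by simp
    ultimately show "returns (1 / real N) (f ^^ n) c d"
      using m[of "(i, j)"] ij cd by (intro returns_later_iterate[OF f]) auto
  qed
  then show "\<exists>n\<ge>1. delta_crooked \<delta> (f ^^ n)" by (intro exI[of _ n]) (auto simp: n_def)
qed

section \<open>The limit of the approximations\<close>

lemma crooked_extension:
  assumes f0: "pushing f0" "\<And>x. 0 \<le> x \<Longrightarrow> x \<le> \<epsilon>0 \<Longrightarrow> f0 x = 2 * x" "0 < \<epsilon>0" "\<epsilon>0 < 1"
  obtains f where "f \<in> extensional I01" "pushing f" "crooked f"
    "\<And>x. \<epsilon>0 \<le> x \<Longrightarrow> x \<le> 1 \<Longrightarrow> f x = f0 x"
proof -
  \<comment> \<open>A state consists of a map and its \<epsilon>. The last conjunct pins the initial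
    state, which dependent choice would leave open.\<close>
  define tame where "tame k s \<longleftrightarrow> pushing (fst s) \<and> 0 < snd s \<and> snd s < (1::real) \<and>
      (\<forall>x. 0 \<le> x \<and> x \<le> snd s \<longrightarrow> fst s x = 2 * x) \<and> (k = 0 \<longrightarrow> s = (f0, \<epsilon>0))"
    for k :: nat and s :: "(real \<Rightarrow> real) \<times> real"
  \<comment> \<open>Stage \<open>k\<close> handles the pair of levels coded by \<open>k\<close>, and
    does so for every map that agrees with the current one from \<open>snd s\<close> on, the limit
    included.\<close>
  define treated where "treated k s \<longleftrightarrow> (\<forall>i j N. from_nat k = (i, j, N) \<and> 0 < i \<and> i < N \<and> 0 < j \<and> j < N \<and> i \<noteq> j \<longrightarrow>
      (\<exists>m. \<forall>h. pushing h \<longrightarrow> (\<forall>x. snd s \<le> x \<and> x \<le> 1 \<longrightarrow> h x = fst s x) \<longrightarrow>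
        bad_crossings (1 / real N) (h ^^ m) (real i / real N) (real j / real N) = {}))"
    for k :: nat and s :: "(real \<Rightarrow> real) \<times> real"
  have "\<exists>s. tame 0 s" using f0 by (intro exI[of _ "(f0, \<epsilon>0)"]) (auto simp: tame_def)
  moreover have "\<exists>t. tame (Suc k) t \<and> (snd t \<le> snd s / 2 \<and>
      (\<forall>x. snd s \<le> x \<and> x \<le> 1 \<longrightarrow> fst t x = fst s x) \<and> treated k t)" if s: "tame k s" for k s
  proof -
    obtain i j N :: nat where ijN: "from_nat k = (i, j, N)" by (cases "from_nat k :: nat \<times> nat \<times> nat") auto
    have s': "pushing (fst s)" "\<And>x. 0 \<le> x \<Longrightarrow> x \<le> snd s \<Longrightarrow> fst s x = 2 * x" "0 < snd s" "snd s < 1"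
      using s by (auto simp: tame_def)
    show ?thesis
    proof (cases "0 < i \<and> i < N \<and> 0 < j \<and> j < N \<and> i \<noteq> j")
      \<comment> \<open>\<open>k\<close> codes no admissible pair, and only \<epsilon> is
        halved.\<close>
      case False
      then show ?thesis
        using s' ijN by (intro exI[of _ "(fst s, snd s / 2)"]) (auto simp: tame_def treated_def)
    next
      case True
      then have ab: "0 < real i / real N" "real i / real N < 1" "0 < real j / real N" "real j / real N < 1"
        "real i / real N \<noteq> real j / real N" "0 < 1 / real N" by (auto simp: field_simps)
      obtain g \<epsilon>' m where g: "pushing g" "0 < \<epsilon>'" "\<epsilon>' \<le> snd s / 2"
        "\<And>x. snd s \<le> x \<Longrightarrow> x \<le> 1 \<Longrightarrow> g x = fst s x"
        "\<And>x. 0 \<le> x \<Longrightarrow> x \<le> \<epsilon>' \<Longrightarrow> g x = 2 * x"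
        "\<And>h. pushing h \<Longrightarrow> (\<And>x. \<epsilon>' \<le> x \<Longrightarrow> x \<le> 1 \<Longrightarrow> h x = g x) \<Longrightarrow>
          bad_crossings (1 / real N) (h ^^ m) (real i / real N) (real j / real N) = {}"
        using crooked_approximation[OF s' ab] by blast
      have "treated k (g, \<epsilon>')"
        unfolding treated_def
      proof (intro allI impI)
        fix i' j' N' :: nat assume "from_nat k = (i', j', N') \<and> 0 < i' \<and> i' < N' \<and> 0 < j' \<and> j' < N' \<and> i' \<noteq> j'"
        then have eq: "i' = i" "j' = j" "N' = N" using ijN by simp_all
        show "\<exists>m. \<forall>h. pushing h \<longrightarrow> (\<forall>x. snd (g, \<epsilon>') \<le> x \<and> x \<le> 1 \<longrightarrow> h x = fst (g, \<epsilon>') x) \<longrightarrow>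
          bad_crossings (1 / real N') (h ^^ m) (real i' / real N') (real j' / real N') = {}"
          unfolding eq by (intro exI[of _ m] allI impI g(6)) auto
      qed
      moreover have "tame (Suc k) (g, \<epsilon>')" using g s'(3,4) by (auto simp: tame_def)
      ultimately show ?thesis using g(3,4) by (intro exI[of _ "(g, \<epsilon>')"]) auto
    qed
  qed
  ultimately obtain s where s: "\<And>k. tame k (s k)" "\<And>k. snd (s (Suc k)) \<le> snd (s k) / 2"
    "\<And>k x. snd (s k) \<le> x \<Longrightarrow> x \<le> 1 \<Longrightarrow> fst (s (Suc k)) x = fst (s k) x" "\<And>k. treated k (s (Suc k))"
    using dependent_nat_choice[of tame "\<lambda>k s t. snd t \<le> snd s / 2 \<and>
      (\<forall>x. snd s \<le> x \<and> x \<le> 1 \<longrightarrow> fst t x = fst s x) \<and> treated k t"] by metis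
  define F E where "F k = fst (s k)" and "E k = snd (s k)" for k
  have F: "pushing (F k)" and E: "0 < E k" "E (Suc k) \<le> E k / 2" for k
    using s(1)[of k] s(2)[of k] by (auto simp: F_def E_def tame_def)
  have F0: "F 0 = f0" "E 0 = \<epsilon>0" using s(1)[of 0] by (auto simp: F_def E_def tame_def)
  have E_less: "\<exists>k. E k < x" if "0 < x" for x
  proof -
    have "E k \<le> (1/2) ^ k * \<epsilon>0" for k
    proof (induction k)
      case (Suc k)
      then show ?case using E(2)[of k] by simp
    qed (simp add: F0)
    moreover have "\<exists>k. (1/2) ^ k < x / \<epsilon>0"
      using real_arch_pow_inv[of "x / \<epsilon>0" "1/2"] that f0(3) by auto
    ultimately show ?thesis using f0(3) by (metis order.strict_trans1 pos_less_divide_eq)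
  qed
  have E_mono: "E j \<le> E k" if "k \<le> j" for j k
    using that
  proof (induction j rule: dec_induct)
    case (step j)
    then show ?case using E[of j] by simp
  qed simp
  have agree: "F j x = F k x" if "k \<le> j" "E k \<le> x" "x \<le> 1" for j k x
    using that(1)
  proof (induction j rule: dec_induct)
    case (step j)
    have "E j \<le> x" using E_mono[OF step(1)] that by simp
    then show ?case using s(3)[of j x] that step by (simp add: F_def E_def)
  qed simp
  \<comment> \<open>For \<open>x > 0\<close> the values \<open>F k x\<close> no longer change once
    \<open>E k \<le> x\<close>. No such \<open>k\<close> exists for \<open>x = 0\<close>, where the
    square root bound will give continuity.\<close>
  define f where "f = restrict (\<lambda>x. if x = 0 then 0 else F (LEAST k. E k \<le> x) x) I01"
  have f_eq: "f x = F k x" if "E k \<le> x" "x \<le> 1" for k x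
  proof -
    have "E (LEAST k. E k \<le> x) \<le> x" "(LEAST k. E k \<le> x) \<le> k"
      using that by (auto intro: LeastI Least_le)
    then have "F k x = F (LEAST k. E k \<le> x) x" using agree that by blast
    moreover have "0 < x" using E(1)[of k] that by simp
    ultimately show ?thesis using that by (simp add: f_def)
  qed
  have f_eq': "\<exists>k. E k < x \<and> f x = F k x" if "0 < x" "x \<le> 1" for x
    using E_less[OF that(1)] f_eq that(2) by (meson less_imp_le)
  have f_zero: "f 0 = 0" by (simp add: f_def)
  have f_sqrt: "f x \<le> 2 * sqrt x" and f_range: "0 \<le> f x" "f x \<le> 1" if "0 \<le> x" "x \<le> 1" for x
  proof -
    have "f x \<le> 2 * sqrt x \<and> 0 \<le> f x \<and> f x \<le> 1"
    proof (cases "x = 0")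
      case False
      then have "0 < x" using that by simp
      then obtain k where "f x = F k x" using f_eq'[OF _ \<open>x \<le> 1\<close>] by blast
      then show ?thesis using pushing_le_sqrt[OF F that] pushing_range[OF F that] by simp
    qed (simp add: f_zero)
    then show "f x \<le> 2 * sqrt x" "0 \<le> f x" "f x \<le> 1" by auto
  qed
  have "continuous_on I01 f"
    unfolding continuous_on_iff
  proof (intro ballI allI impI)
    fix x e :: real assume x: "x \<in> I01" and "0 < e"
    show "\<exists>d>0. \<forall>x'\<in>I01. dist x' x < d \<longrightarrow> dist (f x') (f x) < e"
    proof (cases "x = 0")
      case True
      have "dist (f y) (f x) < e" if "y \<in> I01" "dist y x < (e / 2)\<^sup>2" for y
      proof -
        have "sqrt y < e / 2" using that True \<open>0 < e\<close> by (intro real_less_lsqrt) auto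
        then show ?thesis using f_sqrt[of y] f_range[of y] that True by (simp add: f_zero)
      qed
      then show ?thesis using \<open>0 < e\<close> by (intro exI[of _ "(e / 2)\<^sup>2"]) auto
    next
      case False
      then obtain k where k: "E k < x" using E_less[of x] x by auto
      obtain d where "d > 0" and d: "\<And>y. y \<in> I01 \<Longrightarrow> dist y x < d \<Longrightarrow> dist (F k y) (F k x) < e"
        using F[of k] x \<open>0 < e\<close> unfolding pushing_def continuous_on_iff by meson
      have "dist (f y) (f x) < e" if "y \<in> I01" "dist y x < min d (x - E k)" for y
        using d[of y] f_eq[of k y] f_eq[of k x] that k x by (auto simp: dist_real_def)
      then show ?thesis using \<open>d > 0\<close> k by (intro exI[of _ "min d (x - E k)"]) auto
    qed
  qed
  moreover have "x < f x" if "0 < x" "x < 1" for x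
    using f_eq'[of x] that F by (auto simp: pushing_def)
  moreover have "f 1 = 1" using f_eq'[of 1] pushing_fix(2)[OF F] by auto
  ultimately have f: "pushing f"
    using f_sqrt f_range by (auto simp: pushing_def)
  have "crooked f"
  proof (rule crooked_if_no_bad_crossings[OF f])
    fix i j N :: nat assume ij: "0 < i" "i < N" "0 < j" "j < N" "i \<noteq> j"
    define k where "k = to_nat (i, j, N)"
    have "from_nat k = (i, j, N)" by (simp add: k_def)
    then obtain m where "\<And>h. pushing h \<Longrightarrow> (\<forall>x. snd (s (Suc k)) \<le> x \<and> x \<le> 1 \<longrightarrow> h x = fst (s (Suc k)) x) \<Longrightarrow>
        bad_crossings (1 / real N) (h ^^ m) (real i / real N) (real j / real N) = {}"
      using s(4)[of k] ij unfolding treated_def by blast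
    moreover have "\<forall>x. snd (s (Suc k)) \<le> x \<and> x \<le> 1 \<longrightarrow> f x = fst (s (Suc k)) x"
      using f_eq[of "Suc k"] by (simp add: F_def E_def)
    ultimately show "\<exists>m. bad_crossings (1 / real N) (f ^^ m) (real i / real N) (real j / real N) = {}"
      using f by blast
  qed
  moreover have "f x = f0 x" if "\<epsilon>0 \<le> x" "x \<le> 1" for x
    using f_eq[of 0 x] that F0 by simp
  ultimately show thesis using that[of f] f by (simp add: f_def)
qed

section \<open>Entropy\<close>

text \<open>\<open>F\<close> also witnesses that the infimum ranges over a nonempty set, which the
  lower bound requires.\<close>

lemma spanning_number_bounds:
  assumes "X \<noteq> {}" "finite F" "spanning_set X f n \<epsilon> F"
  shows "1 \<le> spanning_number X f n \<epsilon>" "spanning_number X f n \<epsilon> \<le> card F"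
proof -
  have "1 \<le> card F'" if "finite F'" "spanning_set X f n \<epsilon> F'" for F'
  proof -
    have "F' \<noteq> {}" using that(2) assms(1) by (auto simp: spanning_set_def)
    then show ?thesis using that(1) by (simp add: Suc_le_eq card_gt_0_iff)
  qed
  then show "1 \<le> spanning_number X f n \<epsilon>"
    unfolding spanning_number_def using assms by (intro cINF_greatest) auto
  show "spanning_number X f n \<epsilon> \<le> card F"
    unfolding spanning_number_def using assms by (intro cINF_lower) auto
qed

lemma down_closed_eq_if_card_eq:
  fixes A B :: "nat set"
  assumes "finite A" "finite B" "card A = card B"
    and "\<And>i j. i \<in> A \<Longrightarrow> j \<le> i \<Longrightarrow> j \<in> A" "\<And>i j. i \<in> B \<Longrightarrow> j \<le> i \<Longrightarrow> j \<in> B"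
  shows "A = B"
proof (cases "A \<subseteq> B")
  case True
  then show ?thesis using assms by (simp add: card_subset_eq)
next
  case False
  then obtain x where "x \<in> A" "x \<notin> B" by auto
  then have "B \<subseteq> A" using assms(4,5) by (meson nat_le_linear subsetI)
  then show ?thesis using card_subset_eq[OF assms(1) \<open>B \<subseteq> A\<close>] assms(3) by simp
qed

text \<open>Orbits are increasing, so a coarse itinerary is determined by the times at which it leaves
  the initial segments of the partition, which leaves only polynomially many itineraries.\<close>

lemma pushing_spanning_number_le:
  assumes f: "pushing f" and N: "0 < N" "1 / real N \<le> \<epsilon>"
  shows "1 \<le> spanning_number I01 f n \<epsilon>" "spanning_number I01 f n \<epsilon> \<le> (n + 1) ^ (N + 1)"
proof -
  \<comment> \<open>The bins are 0 to \<open>N\<close>, the last one for \<open>x = 1\<close> alone;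
    hence the exponent \<open>N + 1\<close>.\<close>
  define bin where "bin x = nat \<lfloor>x * real N\<rfloor>" for x :: real
  have bin_le: "bin x \<le> N" if "x \<le> 1" for x
  proof -
    have "x * real N \<le> real N" using mult_right_mono[OF that, of "real N"] by simp
    then have "\<lfloor>x * real N\<rfloor> \<le> int N" by linarith
    then show ?thesis by (simp add: bin_def)
  qed
  have bin_mono: "bin x \<le> bin y" if "x \<le> y" for x y
    unfolding bin_def using that by (intro nat_mono floor_mono mult_right_mono) auto
  define early where "early x j = {i. i < n \<and> bin ((f ^^ i) x) \<le> j}" for x j
  define code where "code x = (\<lambda>j\<in>{..N}. card (early x j))" for x
  have early_down: "i' \<in> early x j" if "x \<in> I01" "i \<in> early x j" "i' \<le> i" for x j i i'
    using that bin_mono[OF pushing_iter_mono[OF f, of x i' i]] by (auto simp: early_def)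
  have code_in: "code ` I01 \<subseteq> {..N} \<rightarrow>\<^sub>E {..n}"
  proof -
    have "card (early x j) \<le> n" for x j
      using card_mono[of "{..<n}" "early x j"] by (auto simp: early_def)
    then show ?thesis by (simp add: code_def image_subset_iff)
  qed
  have fin: "finite ({..N} \<rightarrow>\<^sub>E {..n})" by (intro finite_PiE) auto
  define R where "R = inv_into I01 code ` code ` I01"
  have "finite R" unfolding R_def using finite_subset[OF code_in fin] by simp
  have "card R \<le> card (code ` I01)"
    unfolding R_def by (intro card_image_le finite_subset[OF code_in fin])
  also have "\<dots> \<le> card ({..N} \<rightarrow>\<^sub>E {..n})" by (rule card_mono[OF fin code_in])
  also have "\<dots> = (n + 1) ^ (N + 1)" by (simp add: card_PiE)
  finally have "card R \<le> (n + 1) ^ (N + 1)" .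
  have "spanning_set I01 f n \<epsilon> R"
    unfolding spanning_set_def
  proof (intro conjI ballI)
    show "R \<subseteq> I01" unfolding R_def using inv_into_into[of _ code I01] by auto
    fix x assume x: "x \<in> I01"
    define y where "y = inv_into I01 code (code x)"
    have "code x \<in> code ` I01" using x by simp
    then have y: "y \<in> I01" "code y = code x"
      unfolding y_def by (rule inv_into_into, rule f_inv_into_f)
    have early_eq: "early y j = early x j" if "j \<le> N" for j
    proof (rule down_closed_eq_if_card_eq)
      show "finite (early y j)" "finite (early x j)" by (auto simp: early_def)
      show "card (early y j) = card (early x j)"
        using fun_cong[OF y(2), of j] that by (simp add: code_def)
    qed (use early_down x y(1) in blast)+
    have "dist ((f ^^ i) x) ((f ^^ i) y) \<le> \<epsilon>" if "i < n" for i
    proof -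
      have r: "0 \<le> (f ^^ i) x" "(f ^^ i) x \<le> 1" "0 \<le> (f ^^ i) y" "(f ^^ i) y \<le> 1"
        using pushing_iter_range[OF f] x y(1) by auto
      have "i \<in> early x (bin ((f ^^ i) x))" "i \<in> early y (bin ((f ^^ i) y))"
        using that by (auto simp: early_def)
      then have "i \<in> early y (bin ((f ^^ i) x))" "i \<in> early x (bin ((f ^^ i) y))"
        using early_eq bin_le r by auto
      then have "bin ((f ^^ i) x) = bin ((f ^^ i) y)" by (auto simp: early_def)
      then have "\<lfloor>(f ^^ i) x * real N\<rfloor> = \<lfloor>(f ^^ i) y * real N\<rfloor>"
        using r by (simp add: bin_def eq_nat_nat_iff)
      then have "\<bar>(f ^^ i) x * real N - (f ^^ i) y * real N\<bar> < 1" by linarith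
      then have "\<bar>(f ^^ i) x - (f ^^ i) y\<bar> * real N < 1"
        by (simp add: abs_mult flip: left_diff_distrib)
      then have "\<bar>(f ^^ i) x - (f ^^ i) y\<bar> < 1 / real N" using N(1) by (simp add: field_simps)
      then show ?thesis using N(2) by (simp add: dist_real_def)
    qed
    moreover have "y \<in> R" using x by (simp add: R_def y_def)
    ultimately show "\<exists>y\<in>R. \<forall>i<n. dist ((f ^^ i) x) ((f ^^ i) y) \<le> \<epsilon>" by blast
  qed
  then show "1 \<le> spanning_number I01 f n \<epsilon>" "spanning_number I01 f n \<epsilon> \<le> (n + 1) ^ (N + 1)"
    using spanning_number_bounds[OF _ \<open>finite R\<close>, of I01 f n \<epsilon>] \<open>card R \<le> (n + 1) ^ (N + 1)\<close> by auto
qed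

lemma pushing_entropy:
  assumes f: "pushing f"
  shows "topological_entropy I01 f = 0"
proof -
  have "limsup (\<lambda>n. ereal (ln (real (spanning_number I01 f n \<epsilon>)) / real n)) = 0" if "0 < \<epsilon>" for \<epsilon>
  proof -
    obtain m where "1 / real (Suc m) < \<epsilon>" by (rule nat_approx_posE[OF \<open>0 < \<epsilon>\<close>])
    then obtain N where N: "0 < N" "1 / real N \<le> \<epsilon>" by (meson less_imp_le zero_less_Suc)
    let ?s = "\<lambda>n. real (spanning_number I01 f n \<epsilon>)"
    have s: "1 \<le> ?s n" "?s n \<le> (real n + 1) ^ (N + 1)" for n
    proof -
      show "1 \<le> ?s n" using pushing_spanning_number_le(1)[OF f N, of n] by simp
      have "?s n \<le> real ((n + 1) ^ (N + 1))"
        using pushing_spanning_number_le(2)[OF f N, of n] by (simp only: of_nat_le_iff)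
      then show "?s n \<le> (real n + 1) ^ (N + 1)" by (simp only: of_nat_power of_nat_add of_nat_1)
    qed
    have "(\<lambda>n. ln (?s n) / real n) \<longlonglongrightarrow> 0"
    proof (rule tendsto_sandwich[OF _ _ tendsto_const])
      show "\<forall>\<^sub>F n in sequentially. 0 \<le> ln (?s n) / real n" using s(1) by simp
      have "ln (?s n) \<le> real (N + 1) * ln (real n + 1)" for n
      proof -
        have "ln (?s n) \<le> ln ((real n + 1) ^ (N + 1))"
          using s[of n] by (intro ln_mono) auto
        then show ?thesis by (simp add: ln_realpow del: power_Suc)
      qed
      then show "\<forall>\<^sub>F n in sequentially. ln (?s n) / real n \<le> real (N + 1) * (ln (real n + 1) / real n)"
        by (intro always_eventually allI) (simp add: divide_right_mono del: of_nat_add)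
      have "(\<lambda>n. ln (real n + 1) / real n) \<longlonglongrightarrow> 0" by real_asymp
      then show "(\<lambda>n. real (N + 1) * (ln (real n + 1) / real n)) \<longlonglongrightarrow> 0"
        by (rule tendsto_mult_right_zero)
    qed
    then have "(\<lambda>n. ereal (ln (?s n) / real n)) \<longlonglongrightarrow> 0" by (simp only: zero_ereal_def lim_ereal)
    then show ?thesis by (rule lim_imp_Limsup[OF sequentially_bot])
  qed
  then have "topological_entropy I01 f = (SUP \<epsilon>\<in>{0::real<..}. (0::ereal))"
    unfolding topological_entropy_def by (intro SUP_cong refl) (simp only: greaterThan_iff)
  then show ?thesis by simp
qed

section \<open>Uncountably many conjugacy classes\<close>

text \<open>The orbit of 1/2 under the affine map (1 + x) / 2.\<close>

definition mark :: "nat \<Rightarrow> real" where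
  "mark k = 1 - (1/2) ^ Suc k"

definition complement_blocks :: "nat set \<Rightarrow> real set" where
  "complement_blocks S = {x. \<forall>k\<in>S. \<not> (mark k < x \<and> x < mark (Suc k))}"

text \<open>The distance is a tent of slopes 1 and -1 over each block of \<open>S\<close> and zero
  elsewhere. Being 1-Lipschitz, it alters the slope 1/2 without destroying monotonicity.\<close>

definition ramp :: "nat set \<Rightarrow> real \<Rightarrow> real" where
  "ramp S x = (1 + x) / 2 + infdist x (complement_blocks S) / 2"

text \<open>The turning point \<open>1/2 = mark 0\<close> is the least point from which on the map is monotone, hence
  a conjugacy preserves it together with its orbit, the marks. Inside a block of \<open>S\<close> the ramp has
  slope \<open>1/2 \<plusminus> 1/2\<close>, so it is constant on the right half of the block.\<close>

definition base_map :: "nat set \<Rightarrow> real \<Rightarrow> real" where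
  "base_map S x = min (2 * x) (max (9/4 - 3 * x) (ramp S x))"

lemma mark_bounds: "1/2 \<le> mark k" "mark k < 1"
proof -
  have "(1/2::real) ^ k \<le> 1" by (simp add: power_le_one)
  then show "1/2 \<le> mark k" "mark k < 1" by (simp_all add: mark_def)
qed

lemma mark_Suc: "mark (Suc k) = (1 + mark k) / 2"
  by (simp add: mark_def field_simps)

lemma mark_mono: "i \<le> j \<Longrightarrow> mark i \<le> mark j"
  by (simp add: mark_def power_decreasing)

lemma mark_blocks_disjoint:
  assumes "mark i < x" "x < mark (Suc i)" "mark j \<le> x" "x \<le> mark (Suc j)"
  shows "i = j"
proof (rule ccontr)
  assume "i \<noteq> j"
  then consider "Suc i \<le> j" | "Suc j \<le> i" by linarith
  then show False using mark_mono[of "Suc i" j] mark_mono[of "Suc j" i] assms by cases auto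
qed

lemma in_complement_blocks:
  "x \<le> 1/2 \<Longrightarrow> x \<in> complement_blocks S" "1 \<in> complement_blocks S" "mark k \<in> complement_blocks S"
  "k \<notin> S \<Longrightarrow> mark k \<le> x \<Longrightarrow> x \<le> mark (Suc k) \<Longrightarrow> x \<in> complement_blocks S"
proof -
  show "x \<in> complement_blocks S" if "x \<le> 1/2"
  proof -
    have "\<not> mark i < x" for i using mark_bounds(1)[of i] that by simp
    then show ?thesis by (simp add: complement_blocks_def)
  qed
  have "\<not> 1 < mark (Suc i)" for i using mark_bounds(2)[of "Suc i"] by simp
  then show "1 \<in> complement_blocks S"
    by (simp add: complement_blocks_def)
  have "\<not> (mark i < mark k \<and> mark k < mark (Suc i))" for i
    using mark_mono[of k i] mark_mono[of "Suc i" k] by (cases "k \<le> i") auto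
  then show "mark k \<in> complement_blocks S" by (simp add: complement_blocks_def)
  show "x \<in> complement_blocks S" if "k \<notin> S" "mark k \<le> x" "x \<le> mark (Suc k)"
    unfolding complement_blocks_def using mark_blocks_disjoint[of _ x k] that by blast
qed

lemma ramp_mono:
  assumes "x \<le> y"
  shows "ramp S x \<le> ramp S y"
proof -
  have "dist x y = y - x" using assms by (simp add: dist_real_def)
  then show ?thesis
    using infdist_triangle[of x "complement_blocks S" y] unfolding ramp_def by argo
qed

lemma ramp_ge: "(1 + x) / 2 \<le> ramp S x"
  using infdist_nonneg[of x] by (simp add: ramp_def)

lemma ramp_eq: "x \<in> complement_blocks S \<Longrightarrow> ramp S x = (1 + x) / 2"
  by (simp add: ramp_def)

lemma ramp_le: "x \<le> 1 \<Longrightarrow> ramp S x \<le> 1"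
  using ramp_mono[of x 1 S] ramp_eq[OF in_complement_blocks(2)] by simp

lemma base_map_left:
  assumes "x \<le> 1/2"
  shows "base_map S x = min (2 * x) (9/4 - 3 * x)"
proof -
  have "ramp S x = (1 + x) / 2" by (rule ramp_eq[OF in_complement_blocks(1)[OF assms]])
  then have "ramp S x \<le> 9/4 - 3 * x" using assms by simp
  then show ?thesis by (simp add: base_map_def max_def)
qed

lemma base_map_right: "1/2 \<le> x \<Longrightarrow> x \<le> 1 \<Longrightarrow> base_map S x = ramp S x"
  using ramp_ge[of x S] ramp_le[of x S] by (simp add: base_map_def max_def min_def)

lemma base_map_mark: "base_map S (mark k) = mark (Suc k)"
  using mark_bounds[of k] by (simp add: base_map_right ramp_eq in_complement_blocks mark_Suc)

lemma base_map_mono: "mono_on {1/2..1} (base_map S)"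
  by (intro mono_onI) (auto simp: base_map_right intro: ramp_mono)

lemma base_map_inj_on_block: "inj_on (base_map S) {mark k..mark (Suc k)} \<longleftrightarrow> k \<notin> S"
proof
  assume inj: "inj_on (base_map S) {mark k..mark (Suc k)}"
  show "k \<notin> S"
  proof
    assume "k \<in> S"
    \<comment> \<open>The midpoint has distance \<open>r\<close> from the complement, and
      \<open>r / 2\<close> is exactly what \<open>(1 + m) / 2\<close> lacks to the value at the
      right end.\<close>
    define m where "m = (mark k + mark (Suc k)) / 2"
    define r where "r = (mark (Suc k) - mark k) / 2"
    have lt: "mark k < mark (Suc k)" using mark_bounds(2)[of k] by (simp add: mark_Suc)
    have ne: "complement_blocks S \<noteq> {}" using in_complement_blocks(2) by blast
    have "r \<le> (INF y\<in>complement_blocks S. dist m y)"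
    proof (rule cINF_greatest[OF ne])
      fix y assume "y \<in> complement_blocks S"
      then have "y \<le> mark k \<or> mark (Suc k) \<le> y"
        using \<open>k \<in> S\<close> by (auto simp: complement_blocks_def not_less)
      then show "r \<le> dist m y" by (auto simp: m_def r_def dist_real_def abs_if field_simps)
    qed
    then have "r \<le> infdist m (complement_blocks S)" using ne by (simp add: infdist_def)
    moreover have "infdist m (complement_blocks S) \<le> dist m (mark (Suc k))"
      by (rule infdist_le[OF in_complement_blocks(3)])
    moreover have "dist m (mark (Suc k)) = r"
      using lt by (simp add: m_def r_def dist_real_def field_simps)
    ultimately have "infdist m (complement_blocks S) = r" by simp
    then have "ramp S m = (1 + m) / 2 + r / 2" by (simp add: ramp_def)
    also have "\<dots> = (1 + mark (Suc k)) / 2" by (simp add: m_def r_def field_simps)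
    also have "\<dots> = ramp S (mark (Suc k))" by (simp add: ramp_eq in_complement_blocks)
    finally have "ramp S m = ramp S (mark (Suc k))" .
    moreover have m: "mark k < m" "m < mark (Suc k)" using lt by (auto simp: m_def)
    ultimately have "base_map S m = base_map S (mark (Suc k))"
      using mark_bounds[of k] mark_bounds[of "Suc k"] by (simp add: base_map_right)
    then show False using inj_onD[OF inj, of m "mark (Suc k)"] m lt by auto
  qed
next
  assume "k \<notin> S"
  show "inj_on (base_map S) {mark k..mark (Suc k)}"
  proof (rule inj_onI)
    fix x y assume xy: "x \<in> {mark k..mark (Suc k)}" "y \<in> {mark k..mark (Suc k)}" "base_map S x = base_map S y"
    have eq: "base_map S z = (1 + z) / 2" if "z \<in> {mark k..mark (Suc k)}" for z
      using that mark_bounds[of k] mark_bounds[of "Suc k"] in_complement_blocks(4)[OF \<open>k \<notin> S\<close>]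
      by (simp add: base_map_right ramp_eq)
    have "(1 + x) / 2 = (1 + y) / 2"
      by (simp only: eq[OF xy(1), symmetric] eq[OF xy(2), symmetric] xy(3))
    then show "x = y" by simp
  qed
qed

lemma pushing_base_map: "pushing (base_map S)"
proof -
  have cont: "continuous_on I01 (base_map S)"
    unfolding base_map_def ramp_def by (intro continuous_intros) auto
  have pos: "0 \<le> base_map S x" if "0 \<le> x" for x
    using that ramp_ge[of x S] by (simp add: base_map_def)
  have le1: "base_map S x \<le> 1" if "x \<le> 1" for x
    using that ramp_le[of x S] by (auto simp: base_map_def min_le_iff_disj)
  have gt: "x < base_map S x" if "0 < x" "x < 1" for x
  proof (cases "x \<le> 1/2")
    case True
    then show ?thesis using that by (simp add: base_map_left)
  next
    case False
    then show ?thesis using ramp_ge[of x S] that by (simp add: base_map_right)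
  qed
  have sq: "base_map S x \<le> 2 * sqrt x" if "0 \<le> x" "x \<le> 1" for x
  proof -
    have "x\<^sup>2 \<le> x" using that by (simp add: power2_eq_square mult_left_le)
    then have "x \<le> sqrt x" by (rule real_le_rsqrt)
    then show ?thesis by (simp add: base_map_def min_le_iff_disj)
  qed
  have "base_map S 1 = 1" by (simp add: base_map_right ramp_eq in_complement_blocks)
  then show ?thesis using cont pos le1 gt sq by (auto simp: pushing_def)
qed

section \<open>The conjugacy invariant\<close>

lemma mono_on_base_map_extension_iff:
  assumes f: "\<And>x. 1/4 \<le> x \<Longrightarrow> x \<le> 1 \<Longrightarrow> f x = base_map S x" and x: "x \<in> I01"
  shows "mono_on {x..1} f \<longleftrightarrow> 1/2 \<le> x"
proof
  assume mono: "mono_on {x..1} f"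
  show "1/2 \<le> x"
  proof (rule ccontr)
    assume "\<not> 1/2 \<le> x"
    \<comment> \<open>From the peak at 9/20 to 1/2 the map falls; \<open>y\<close> is chosen there,
      within the region where \<open>f\<close> is prescribed.\<close>
    define y where "y = max x (9/20)"
    have y: "x \<le> y" "9/20 \<le> y" "y < 1/2" using \<open>\<not> 1/2 \<le> x\<close> by (auto simp: y_def)
    have "f y \<le> f (1/2)" using y by (intro mono_onD[OF mono]) auto
    then show False using y f[of y] f[of "1/2"] by (simp add: base_map_left)
  qed
next
  assume "1/2 \<le> x"
  show "mono_on {x..1} f"
  proof (rule mono_onI)
    fix r s assume "r \<in> {x..1}" "s \<in> {x..1}" "r \<le> s"
    then show "f r \<le> f s"
      using mono_onD[OF base_map_mono, of r s S] f[of r] f[of s] \<open>1/2 \<le> x\<close> by auto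
  qed
qed

text \<open>\<open>h\<close> carries an end interval on which \<open>f\<close> is monotone to one on
  which \<open>g\<close> is. Used for \<open>h\<close> and for its inverse, this gives
  \<open>h (1/2) = 1/2\<close>.\<close>

lemma conjugate_turning_point_ge:
  assumes f: "\<And>x. 1/4 \<le> x \<Longrightarrow> x \<le> 1 \<Longrightarrow> f x = base_map S x" "\<And>x. x \<in> I01 \<Longrightarrow> f x \<in> I01"
    and g: "\<And>x. 1/4 \<le> x \<Longrightarrow> x \<le> 1 \<Longrightarrow> g x = base_map S' x"
    and h: "strict_mono_on I01 h" "h ` I01 = I01"
    and conj: "\<And>x. x \<in> I01 \<Longrightarrow> h (f x) = g (h x)"
  shows "1/2 \<le> h (1/2)"
proof -
  have h_in: "h x \<in> I01" if "x \<in> I01" for x using h(2) that by blast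
  have mono: "mono_on {1/2..1} f" using mono_on_base_map_extension_iff[of f S "1/2"] f(1) by auto
  have "mono_on {h (1/2)..1} g"
  proof (rule mono_onI)
    fix r s assume rs: "r \<in> {h (1/2)..1}" "s \<in> {h (1/2)..1}" "r \<le> s"
    have "0 \<le> h (1/2)" using h_in[of "1/2"] by simp
    then have "r \<in> I01" "s \<in> I01" using rs by auto
    then have "r \<in> h ` I01" "s \<in> h ` I01" by (simp_all only: h(2))
    then obtain r' s' where r's': "r' \<in> I01" "s' \<in> I01" "r = h r'" "s = h s'" by blast
    have le: "x \<le> y" if "x \<in> I01" "y \<in> I01" "h x \<le> h y" for x y
      using strict_mono_onD[OF h(1), of y x] that by (meson not_le)
    have "1/2 \<le> r'" "r' \<le> s'" using le[of "1/2" r'] le[of r' s'] rs r's' by auto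
    then have "f r' \<le> f s'" using r's' by (intro mono_onD[OF mono]) auto
    then have "h (f r') \<le> h (f s')"
      using strict_mono_on_leD[OF h(1)] f(2) r's' by blast
    then show "g r \<le> g s" using conj r's' by simp
  qed
  then show ?thesis using mono_on_base_map_extension_iff[of g S' "h (1/2)"] g h_in[of "1/2"] by auto
qed

text \<open>With 1/2 the conjugacy fixes all marks and maps every block into itself, so a failure of
  injectivity on a block carries over from \<open>f\<close> to \<open>g\<close>.\<close>

lemma conjugate_imp_subset:
  assumes f: "\<And>x. 1/4 \<le> x \<Longrightarrow> x \<le> 1 \<Longrightarrow> f x = base_map S x"
    and g: "\<And>x. 1/4 \<le> x \<Longrightarrow> x \<le> 1 \<Longrightarrow> g x = base_map S' x"
    and h: "strict_mono_on I01 h" "h ` I01 = I01" "h (1/2) = 1/2"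
    and conj: "\<And>x. x \<in> I01 \<Longrightarrow> h (f x) = g (h x)"
  shows "S \<subseteq> S'"
proof
  fix k assume "k \<in> S"
  have fm: "f (mark i) = mark (Suc i)" and gm: "g (mark i) = mark (Suc i)" for i
    using f[of "mark i"] g[of "mark i"] mark_bounds[of i] by (auto simp: base_map_mark)
  have hm: "h (mark i) = mark i" for i
  proof (induction i)
    case 0
    then show ?case using h(3) by (simp add: mark_def)
  next
    case (Suc i)
    then show ?case using conj[of "mark i"] fm gm mark_bounds[of i] by simp
  qed
  define B where "B = {mark k..mark (Suc k)}"
  have B: "B \<subseteq> I01" "\<And>x. x \<in> B \<Longrightarrow> 1/4 \<le> x \<and> x \<le> 1"
    using mark_bounds[of k] mark_bounds[of "Suc k"] by (auto simp: B_def)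
  have "\<not> inj_on f B"
    using base_map_inj_on_block[of S k] \<open>k \<in> S\<close> f B(2) inj_on_cong[of B f "base_map S"] by (auto simp: B_def)
  then obtain x y where xy: "x \<in> B" "y \<in> B" "x \<noteq> y" "f x = f y" by (auto simp: inj_on_def)
  have hB: "h z \<in> B" if "z \<in> B" for z
  proof -
    have "mark k \<in> I01" "mark (Suc k) \<in> I01" "z \<in> I01" using mark_bounds[of k] mark_bounds[of "Suc k"] that B by auto
    then have "h (mark k) \<le> h z" "h z \<le> h (mark (Suc k))"
      using that by (auto simp: B_def intro!: strict_mono_on_leD[OF h(1)])
    then show ?thesis by (simp add: hm B_def)
  qed
  have "h x \<noteq> h y" using xy B strict_mono_on_imp_inj_on[OF h(1)] by (auto dest: inj_onD)
  moreover have "g (h x) = g (h y)"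
  proof -
    have "x \<in> I01" "y \<in> I01" using xy(1,2) B(1) by blast+
    then show ?thesis by (simp only: conj[symmetric] xy(4))
  qed
  ultimately have "\<not> inj_on (base_map S') B"
    using hB[OF xy(1)] hB[OF xy(2)] g B(2) by (metis inj_onD)
  then show "k \<in> S'" using base_map_inj_on_block[of S' k] by (auto simp: B_def)
qed

lemma conjugate_imp_eq:
  assumes f: "pushing f" "\<And>x. 1/4 \<le> x \<Longrightarrow> x \<le> 1 \<Longrightarrow> f x = base_map S x"
    and g: "pushing g" "\<And>x. 1/4 \<le> x \<Longrightarrow> x \<le> 1 \<Longrightarrow> g x = base_map S' x"
    and "conjugate_maps f g"
  shows "S = S'"
proof -
  obtain h h' where hom: "homeomorphism I01 I01 h h'" and gh: "\<And>x. x \<in> I01 \<Longrightarrow> g x = h (f (h' x))"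
    using assms(5) unfolding conjugate_maps_def by blast
  have h: "h ` I01 = I01" "continuous_on I01 h" "\<And>x. x \<in> I01 \<Longrightarrow> h' (h x) = x"
    and h': "h' ` I01 = I01" "\<And>x. x \<in> I01 \<Longrightarrow> h (h' x) = x"
    using hom by (auto simp: homeomorphism_def)
  have h_in: "h x \<in> I01" and h'_in: "h' x \<in> I01" if "x \<in> I01" for x using h(1) h'(1) that by blast+
  have f_in: "f x \<in> I01" and g_in: "g x \<in> I01" if "x \<in> I01" for x
    using pushing_range[OF f(1), of x] pushing_range[OF g(1), of x] that by auto
  have conj: "h (f x) = g (h x)" if "x \<in> I01" for x
    using gh[of "h x"] h(3)[OF that] h_in[OF that] by simp
  have conj': "h' (g x) = f (h' x)" if "x \<in> I01" for x
    using gh[OF that] h(3) f_in h'_in that by simp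
  have "inj_on h I01" using h(3) by (metis inj_onI)
  then have "strict_mono_on I01 h \<or> strict_antimono_on I01 h"
    using injective_eq_monotone_map[of I01 h] h(2) by (simp add: is_interval_cc)
  \<comment> \<open>A decreasing \<open>h\<close> would turn the upward push of \<open>f\<close>
    into a downward one of \<open>g\<close>.\<close>
  moreover have "\<not> strict_antimono_on I01 h"
  proof
    assume anti: "strict_antimono_on I01 h"
    have "1/2 < f (1/2)" by (rule pushing_less[OF f(1)]) auto
    then have "h (f (1/2)) < h (1/2)" using monotone_onD[OF anti, of "1/2" "f (1/2)"] f_in[of "1/2"] by auto
    moreover have "h (1/2) \<le> g (h (1/2))" using pushing_ge[OF g(1)] h_in[of "1/2"] by simp
    ultimately show False using conj[of "1/2"] by simp
  qed
  ultimately have mono: "strict_mono_on I01 h" by blast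
  have mono': "strict_mono_on I01 h'"
  proof (rule strict_mono_onI)
    fix r s assume rs: "r \<in> I01" "s \<in> I01" "r < s"
    show "h' r < h' s"
    proof (rule ccontr)
      assume "\<not> h' r < h' s"
      then have "h (h' s) \<le> h (h' r)"
        using rs h'_in by (intro strict_mono_on_leD[OF mono]) auto
      then show False using rs h'(2) by simp
    qed
  qed
  have "1/2 \<le> h (1/2)"
    using conjugate_turning_point_ge[of f S g S' h] f(2) f_in g(2) mono h(1) conj by blast
  moreover have "1/2 \<le> h' (1/2)"
    using conjugate_turning_point_ge[of g S' f S h'] g(2) g_in f(2) mono' h'(1) conj' by blast
  then have "h (1/2) \<le> h (h' (1/2))"
    using h'_in[of "1/2"] by (intro strict_mono_on_leD[OF mono]) auto
  ultimately have half: "h (1/2) = 1/2" using h'(2)[of "1/2"] by simp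
  have "h' (h (1/2)) = 1/2" by (rule h(3)) simp
  then have half': "h' (1/2) = 1/2" by (simp only: half)
  have "S \<subseteq> S'"
    using conjugate_imp_subset[of f S g S' h] f(2) g(2) mono h(1) half conj by blast
  moreover have "S' \<subseteq> S"
    using conjugate_imp_subset[of g S' f S h'] f(2) g(2) mono' h'(1) half' conj' by blast
  ultimately show ?thesis by blast
qed

lemma conjugate_maps_refl: "f ` I01 \<subseteq> I01 \<Longrightarrow> conjugate_maps f f"
  unfolding conjugate_maps_def
  by (intro exI[of _ "\<lambda>x. x"]) (auto simp: homeomorphism_def)

theorem corollary4p8:
  shows "\<exists>T. T \<subseteq> C_I \<and> uncountable T \<and>
           (\<forall>f\<in>T. crooked f \<and> topological_entropy I01 f = 0) \<and>
           (\<forall>f\<in>T. \<forall>g\<in>T. f \<noteq> g \<longrightarrow> \<not> conjugate_maps f g)"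
proof -
  have "\<exists>f. f \<in> extensional I01 \<and> pushing f \<and> crooked f \<and>
      (\<forall>x. 1/4 \<le> x \<and> x \<le> 1 \<longrightarrow> f x = base_map S x)" for S
  proof -
    have "base_map S x = 2 * x" if "0 \<le> x" "x \<le> 1/4" for x
      using that by (simp add: base_map_left)
    then obtain f where "f \<in> extensional I01" "pushing f" "crooked f"
      "\<And>x. 1/4 \<le> x \<Longrightarrow> x \<le> 1 \<Longrightarrow> f x = base_map S x"
      using crooked_extension[OF pushing_base_map, of "1/4" S] by auto
    then show ?thesis by blast
  qed
  then obtain \<Phi> where ext: "\<And>S. \<Phi> S \<in> extensional I01" and push: "\<And>S. pushing (\<Phi> S)"
    and crook: "\<And>S. crooked (\<Phi> S)" and base: "\<And>S x. 1/4 \<le> x \<Longrightarrow> x \<le> 1 \<Longrightarrow> \<Phi> S x = base_map S x"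
    by metis
  have conj: "S = S'" if "conjugate_maps (\<Phi> S) (\<Phi> S')" for S S'
    using conjugate_imp_eq[OF push base push base that] .
  have image: "\<Phi> S ` I01 = I01" for S
  proof
    show "\<Phi> S ` I01 \<subseteq> I01" using push by (simp add: pushing_def)
    show "I01 \<subseteq> \<Phi> S ` I01"
    proof
      fix y assume "y \<in> I01"
      then have "y \<in> closed_segment (\<Phi> S 0) (\<Phi> S 1)"
        using pushing_fix[OF push] by (simp add: closed_segment_eq_real_ivl)
      then have "\<exists>x\<in>closed_segment 0 1. \<Phi> S x = y"
        using push by (intro segment_value) (auto simp: pushing_def)
      then show "y \<in> \<Phi> S ` I01" by (auto simp: closed_segment_eq_real_ivl)
    qed
  qed
  \<comment> \<open>Equal maps are conjugate, so this is a special case of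
    \<open>conj\<close>.\<close>
  have "inj \<Phi>"
    using conj conjugate_maps_refl image by (metis injI order_refl)
  moreover have "uncountable (UNIV :: nat set set)"
  proof
    assume "countable (UNIV :: nat set set)"
    then have "range (from_nat_into UNIV) = (UNIV :: nat set set)" by (intro range_from_nat_into) auto
    then show False using Cantors_theorem[of "UNIV :: nat set"] by auto
  qed
  ultimately have "uncountable (range \<Phi>)" using countable_image_inj_on by blast
  moreover have "\<Phi> S \<in> C_I" for S
  proof -
    have "continuous_on I01 (\<Phi> S)" using push by (simp add: pushing_def)
    then show ?thesis using ext image by (simp add: C_I_def)
  qed
  moreover have "\<not> conjugate_maps f g" if "f \<in> range \<Phi>" "g \<in> range \<Phi>" "f \<noteq> g" for f g
    using that conj by blast
  ultimately show ?thesis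
    using crook pushing_entropy[OF push] by (intro exI[of _ "range \<Phi>"] conjI ballI impI) auto
qed

end
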